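(* Let $k\ge 0$ be an integer, let $x,y\in\Omega$ with $x\neq y$, and let $(X,Y)$ be a coupling of $P_x$ and $P_y$. Then $$\kappa_{k+1}(x,y)\ \ge\ 1-\mathbb{E}\left(\frac{d(X,Y)\,(1-\kappa_k(X,Y))}{d(x,y)}\right).$$ If moreover $\mathbb{E}(d(X,Y))=W_1(P_x,P_y)$ (i.e. the coupling achieves the Wasserstein distance), then $$\kappa_{k+1}(x,y)\ \ge\ \kappa_1(x,y)+\mathbb{E}\left(\frac{\kappa_k(X,Y)\,d(X,Y)}{d(x,y)}\right).$$
   Context: $(\Omega,d)$ is a Polish metric space (complete, separable) and $P(x,\mathrm{d}y)$ is a Markov kernel on $\Omega$, depending measurably on $x$; write $P_x=P(x,\cdot)$. It is assumed that $W_1(\delta_x,P_x)<\infty$ for every $x\in\Omega$. $P^k_x=P^k(x,\cdot)$ is the $k$-step kernel, $P^0_x=\delta_x$. The $L^1$ Wasserstein distance is $W_1(\mu_1,\mu_2)=\inf_{(X,Y)}\mathbb{E}(d(X,Y))$, the infimum over all couplings $(X,Y)$ of $\mu_1,\mu_2$ (random pairs with these marginals). For an integer $k\ge 0$ the multi-step coarse Ricci curvature is $\kappa_k(x,y)=1-W_1(P^k_x,P^k_y)/d(x,y)$ if $x\ne y$, and $\kappa_k(x,x)=1$. *)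

theory Defs
  imports "HOL-Probability.Probability"
begin

text \<open>
  A random pair \<open>(X, Y)\<close>, defined on an arbitrary probability space, with marginal laws
  \<open>\<mu>\<close> and \<open>\<nu>\<close>.
\<close>
definition coupling ::
  "'b measure \<Rightarrow> ('b \<Rightarrow> 'a) \<Rightarrow> ('b \<Rightarrow> 'a) \<Rightarrow> 'a measure \<Rightarrow> 'a::topological_space measure \<Rightarrow> bool"
where
  "coupling M X Y \<mu> \<nu> \<longleftrightarrow>
     prob_space M \<and> X \<in> borel_measurable M \<and> Y \<in> borel_measurable M \<and>
     distr M borel X = \<mu> \<and> distr M borel Y = \<nu>"

text \<open>
  The infimum ranges over random pairs realised on the product space itself. This is no
  restriction, since the expected distance depends only on the joint law. The value may
  be \<open>\<infinity>\<close>.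
\<close>
definition W1 :: "'a::polish_space measure \<Rightarrow> 'a measure \<Rightarrow> ennreal" where
  "W1 \<mu> \<nu> =
     (INF \<pi> \<in> {\<pi>. sets \<pi> = sets (borel \<Otimes>\<^sub>M borel) \<and> coupling \<pi> fst snd \<mu> \<nu>}.
        \<integral>\<^sup>+ p. ennreal (dist (fst p) (snd p)) \<partial>\<pi>)"

primrec step_kernel :: "('a::polish_space \<Rightarrow> 'a measure) \<Rightarrow> nat \<Rightarrow> 'a \<Rightarrow> 'a measure" where
  "step_kernel P 0 x = return borel x"
| "step_kernel P (Suc k) x = bind (P x) (step_kernel P k)"

text \<open>
  Extended-real valued: finiteness of \<open>W1 (return borel x) (P x)\<close> for all \<open>x\<close> does not
  force \<open>W1\<close> between the \<open>k\<close>-step kernels to be finite for \<open>k \<ge> 2\<close>, and then the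
  curvature is \<open>-\<infinity>\<close>.
\<close>
definition ricci_curv :: "('a::polish_space \<Rightarrow> 'a measure) \<Rightarrow> nat \<Rightarrow> 'a \<Rightarrow> 'a \<Rightarrow> ereal" where
  "ricci_curv P k x y =
     (if x = y then 1
      else 1 - enn2ereal (W1 (step_kernel P k x) (step_kernel P k y)) / ereal (dist x y))"

text \<open>
  Expectation of an extended-real random variable, as the integral of the positive part minus
  that of the negative part (\<open>e2ennreal\<close> sends negative numbers to \<open>0\<close>). It is meaningful when
  at least one of the two is finite.
\<close>
definition ereal_expectation :: "'b measure \<Rightarrow> ('b \<Rightarrow> ereal) \<Rightarrow> ereal" where
  "ereal_expectation M f =
     enn2ereal (\<integral>\<^sup>+ w. e2ennreal (f w) \<partial>M) - enn2ereal (\<integral>\<^sup>+ w. e2ennreal (- f w) \<partial>M)"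

end

theory Submission
  imports Defs "HOL-Complex_Analysis.Great_Picard"
begin

text \<open>
  Kantorovich--Rubinstein duality replaces the measurable selection of optimal couplings of
  \<open>P\<^sup>k\<^sub>X\<close> and \<open>P\<^sup>k\<^sub>Y\<close>. The distance \<open>W\<^sub>1(P\<^sup>k\<^sup>+\<^sup>1\<^sub>x, P\<^sup>k\<^sup>+\<^sup>1\<^sub>y)\<close> is the supremum over bounded 1-Lipschitz \<open>f\<close> of
  \<open>\<integral>f dP\<^sup>k\<^sup>+\<^sup>1\<^sub>x - \<integral>f dP\<^sup>k\<^sup>+\<^sup>1\<^sub>y = \<bbbE>(u\<^sub>f(X, Y))\<close> with \<open>u\<^sub>f(X, Y) = \<integral>f dP\<^sup>k\<^sub>X - \<integral>f dP\<^sup>k\<^sub>Y \<le> W\<^sub>1(P\<^sup>k\<^sub>X, P\<^sup>k\<^sub>Y)\<close>.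
  Each \<open>u\<^sub>f\<close> is measurable, so it is irrelevant whether \<open>W\<^sub>1(P\<^sup>k\<^sub>X, P\<^sup>k\<^sub>Y)\<close> is. In the duality
  itself, an optimal coupling of two laws on a countable set exists by compactness. Its support
  is cyclically monotone and so carries a potential. Partitioning into small cells reduces
  Polish spaces to this case.
\<close>

subsection \<open>Laws on countable sets and their couplings\<close>

text \<open>Bridges two views of a nonnegative series: integrals over counting measure offer
  Tonelli, while real-valued \<open>has_sum\<close> allows subtraction.\<close>

lemma nn_integral_count_space_has_sum_iff:
  fixes f :: "'i \<Rightarrow> real"
  assumes nonneg: "\<And>x. f x \<ge> 0" and r: "r \<ge> 0"
  shows "(\<integral>\<^sup>+x. ennreal (f x) \<partial>count_space UNIV) = ennreal r \<longleftrightarrow> (f has_sum r) UNIV"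
proof
  assume *: "(\<integral>\<^sup>+x. ennreal (f x) \<partial>count_space UNIV) = ennreal r"
  have "integrable (count_space UNIV) f"
    using * nonneg by (intro integrableI_nonneg) auto
  then have s: "Infinite_Set_Sum.abs_summable_on f UNIV"
    by (simp add: Infinite_Set_Sum.abs_summable_on_def)
  then have "ennreal (infsum f UNIV) = ennreal r"
    using * nonneg by (simp add: nn_integral_conv_infsetsum infsetsum_infsum)
  moreover have "infsum f UNIV \<ge> 0"
    using nonneg by (simp add: infsum_nonneg)
  moreover have "f summable_on UNIV"
    using s abs_summable_equivalent abs_summable_summable by blast
  ultimately show "(f has_sum r) UNIV"
    using r by (simp add: has_sum_iff)
next
  assume *: "(f has_sum r) UNIV"
  then have "(\<lambda>x. norm (f x)) summable_on UNIV"
    using nonneg by (auto simp: has_sum_iff)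
  then have s: "Infinite_Set_Sum.abs_summable_on f UNIV"
    using abs_summable_equivalent by blast
  then show "(\<integral>\<^sup>+x. ennreal (f x) \<partial>count_space UNIV) = ennreal r"
    using * nonneg by (simp add: nn_integral_conv_infsetsum infsetsum_infsum has_sum_iff)
qed

text \<open>Finite partial sums pass to pointwise limits, so cost bounds are carried to limit
  couplings in this form.\<close>

lemma nn_integral_count_space_le_iff:
  fixes f :: "'i \<Rightarrow> real"
  assumes nonneg: "\<And>x. f x \<ge> 0" and r: "r \<ge> 0"
  shows "(\<integral>\<^sup>+x. ennreal (f x) \<partial>count_space UNIV) \<le> ennreal r \<longleftrightarrow> (\<forall>F. finite F \<longrightarrow> sum f F \<le> r)"
proof
  assume *: "(\<integral>\<^sup>+x. ennreal (f x) \<partial>count_space UNIV) \<le> ennreal r"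
  show "\<forall>F. finite F \<longrightarrow> sum f F \<le> r"
  proof safe
    fix F :: "'i set" assume F: "finite F"
    have "ennreal (sum f F) = (\<integral>\<^sup>+x. ennreal (f x) \<partial>count_space F)"
      using F nonneg by (simp add: nn_integral_count_space_finite)
    also have "\<dots> = (\<integral>\<^sup>+x. ennreal (f x) * indicator F x \<partial>count_space UNIV)"
      by (simp add: nn_integral_count_space_indicator)
    also have "\<dots> \<le> (\<integral>\<^sup>+x. ennreal (f x) \<partial>count_space UNIV)"
      by (intro nn_integral_mono) (auto split: split_indicator)
    also note *
    finally show "sum f F \<le> r" using r by simp
  qed
next
  assume *: "\<forall>F. finite F \<longrightarrow> sum f F \<le> r"
  then have s: "f summable_on UNIV"
    using nonneg by (intro nonneg_bdd_above_summable_on bdd_aboveI[of _ r]) auto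
  have "infsum f UNIV \<le> r"
    using s * by (intro infsum_le_finite_sums) auto
  moreover have "(\<integral>\<^sup>+x. ennreal (f x) \<partial>count_space UNIV) = ennreal (infsum f UNIV)"
    using s nonneg by (subst nn_integral_count_space_has_sum_iff) (auto intro: infsum_nonneg)
  ultimately show "(\<integral>\<^sup>+x. ennreal (f x) \<partial>count_space UNIV) \<le> ennreal r"
    by (simp add: ennreal_leI)
qed

section \<open>Discrete couplings as arrays with prescribed row and column sums\<close>

definition pmf_couplings :: "'i pmf \<Rightarrow> 'j pmf \<Rightarrow> ('i \<times> 'j) pmf set" where
  "pmf_couplings p q = {\<pi>. map_pmf fst \<pi> = p \<and> map_pmf snd \<pi> = q}"

lemma pmf_map_fst_has_sum: "((\<lambda>j. pmf \<pi> (i, j)) has_sum pmf (map_pmf fst \<pi>) i) UNIV"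
proof -
  have "(\<integral>\<^sup>+j. ennreal (pmf \<pi> (i, j)) \<partial>count_space UNIV) = emeasure \<pi> (range (Pair i))"
    by (rule nn_integral_pmf') (simp add: inj_on_def)
  also have "range (Pair i) = fst -` {i}"
    by auto
  finally have "(\<integral>\<^sup>+j. ennreal (pmf \<pi> (i, j)) \<partial>count_space UNIV) = ennreal (pmf (map_pmf fst \<pi>) i)"
    by (simp add: pmf_map measure_pmf.emeasure_eq_measure)
  then show ?thesis
    by (subst (asm) nn_integral_count_space_has_sum_iff) auto
qed

lemma pmf_map_snd_has_sum: "((\<lambda>i. pmf \<pi> (i, j)) has_sum pmf (map_pmf snd \<pi>) j) UNIV"
proof -
  have "(\<integral>\<^sup>+i. ennreal (pmf \<pi> (i, j)) \<partial>count_space UNIV) = emeasure \<pi> (range (\<lambda>i. (i, j)))"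
    by (rule nn_integral_pmf') (simp add: inj_on_def)
  also have "range (\<lambda>i. (i, j)) = snd -` {j}"
    by auto
  finally have "(\<integral>\<^sup>+i. ennreal (pmf \<pi> (i, j)) \<partial>count_space UNIV) = ennreal (pmf (map_pmf snd \<pi>) j)"
    by (simp add: pmf_map measure_pmf.emeasure_eq_measure)
  then show ?thesis
    by (subst (asm) nn_integral_count_space_has_sum_iff) auto
qed

lemma pmf_has_sum_1: "(pmf p has_sum 1) UNIV"
  using nn_integral_count_space_has_sum_iff[of "pmf p" 1] by (simp add: nn_integral_pmf)

text \<open>Nonnegativity and the marginal sums suffice: by Tonelli the total mass is the sum of the
  row sums, hence the mass 1 of \<open>p\<close>.\<close>

lemma pmf_coupling_exists:
  fixes f :: "'i \<times> 'j \<Rightarrow> real"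
  assumes nonneg: "\<And>z. f z \<ge> 0"
    and rows: "\<And>i. ((\<lambda>j. f (i, j)) has_sum pmf p i) UNIV"
    and cols: "\<And>j. ((\<lambda>i. f (i, j)) has_sum pmf q j) UNIV"
  obtains \<pi> where "\<pi> \<in> pmf_couplings p q" "pmf \<pi> = f"
proof -
  have "(\<integral>\<^sup>+z. ennreal (f z) \<partial>count_space UNIV) =
      (\<integral>\<^sup>+i. \<integral>\<^sup>+j. ennreal (f (i, j)) \<partial>count_space UNIV \<partial>count_space UNIV)"
    by (rule nn_integral_fst_count_space[symmetric])
  also have "\<dots> = (\<integral>\<^sup>+i. ennreal (pmf p i) \<partial>count_space UNIV)"
    using rows nonneg by (intro nn_integral_cong) (simp add: nn_integral_count_space_has_sum_iff)
  also have "\<dots> = 1"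
    by (simp add: nn_integral_pmf)
  finally have *: "pmf (embed_pmf f) = f"
    using nonneg by (simp add: pmf_embed_pmf fun_eq_iff)
  have "pmf (map_pmf fst (embed_pmf f)) i = pmf p i" for i
    using pmf_map_fst_has_sum[of "embed_pmf f" i] rows[of i] unfolding * by (rule has_sum_unique)
  moreover have "pmf (map_pmf snd (embed_pmf f)) j = pmf q j" for j
    using pmf_map_snd_has_sum[of "embed_pmf f" j] cols[of j] unfolding * by (rule has_sum_unique)
  ultimately have "embed_pmf f \<in> pmf_couplings p q"
    by (simp add: pmf_couplings_def pmf_eq_iff)
  with * that show ?thesis by blast
qed

text \<open>Domination by a fixed summable function prevents mass from escaping to infinity.\<close>

lemma has_sum_limit_dominated:
  fixes f :: "nat \<Rightarrow> 'i \<Rightarrow> real"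
  assumes lim: "\<And>x. (\<lambda>n. f n x) \<longlonglongrightarrow> g x"
    and sums: "\<And>n. (f n has_sum s) UNIV"
    and dom: "\<And>n x. 0 \<le> f n x" "\<And>n x. f n x \<le> h x"
    and h: "h summable_on UNIV"
  shows "(g has_sum s) UNIV"
proof -
  obtain t where t: "(h has_sum t) UNIV"
    using h by (auto simp: summable_on_def)
  have upper: "sum g F \<le> s" if "finite F" for F
  proof (rule LIMSEQ_le_const2)
    show "(\<lambda>n. sum (f n) F) \<longlonglongrightarrow> sum g F"
      by (intro tendsto_sum lim)
    show "\<exists>N. \<forall>n\<ge>N. sum (f n) F \<le> s"
      using that dom(1) finite_sum_le_has_sum[OF sums, of F] by simp
  qed
  \<comment> \<open>The nonnegative remainder \<open>h - f n\<close> shows that at most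
    \<open>t - sum h F\<close> of the mass of \<open>f n\<close> lies outside \<open>F\<close>,
    uniformly in \<open>n\<close>.\<close>
  have lower: "s - (t - sum h F) \<le> sum g F" if F: "finite F" for F
  proof (rule LIMSEQ_le_const)
    show "(\<lambda>n. sum (f n) F) \<longlonglongrightarrow> sum g F"
      by (intro tendsto_sum lim)
    have "s - (t - sum h F) \<le> sum (f n) F" for n
    proof -
      have "((\<lambda>x. h x - f n x) has_sum (t - s)) UNIV"
        using has_sum_add[OF t, of "\<lambda>x. - f n x" "- s"] sums[of n] by (simp add: has_sum_uminus)
      then have "sum (\<lambda>x. h x - f n x) F \<le> t - s"
        using F dom by (intro finite_sum_le_has_sum[where A=UNIV]) auto
      then show ?thesis by (simp add: sum_subtractf)
    qed
    then show "\<exists>N. \<forall>n\<ge>N. s - (t - sum h F) \<le> sum (f n) F" by blast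
  qed
  have "((\<lambda>F. s - (t - sum h F)) \<longlongrightarrow> s - (t - t)) (finite_subsets_at_top UNIV)"
    using t unfolding has_sum_def by (intro tendsto_intros)
  moreover have "\<forall>\<^sub>F F in finite_subsets_at_top UNIV. s - (t - sum h F) \<le> sum g F"
    by (rule eventually_finite_subsets_at_top_weakI) (use lower in auto)
  moreover have "\<forall>\<^sub>F F in finite_subsets_at_top UNIV. sum g F \<le> s"
    by (rule eventually_finite_subsets_at_top_weakI) (use upper in auto)
  ultimately show ?thesis
    unfolding has_sum_def by (intro tendsto_sandwich[of _ "sum g" _ "\<lambda>_. s" s]) auto
qed

text \<open>Entries lie in [0, 1], so a diagonal argument over the countable index set gives
  pointwise limits. The fixed marginals dominate rows and columns, so no mass is lost in the
  limit.\<close>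

lemma pmf_couplings_seq_compact:
  fixes p :: "'i::countable pmf" and q :: "'j::countable pmf"
  assumes \<pi>: "\<And>n::nat. \<pi> n \<in> pmf_couplings p q"
  obtains r \<rho> where "strict_mono r" "\<rho> \<in> pmf_couplings p q"
    "\<And>z. (\<lambda>n. pmf (\<pi> (r n)) z) \<longlonglongrightarrow> pmf \<rho> z"
proof -
  obtain r where r: "strict_mono (r :: nat \<Rightarrow> nat)"
    and "\<exists>l. (\<lambda>n. pmf (\<pi> (r n)) z) \<longlonglongrightarrow> l" for z
    by (rule function_convergent_subsequence[of "UNIV" "\<lambda>n z. pmf (\<pi> n) z" 1])
      (auto simp: pmf_le_1)
  then obtain l where l: "\<And>z. (\<lambda>n. pmf (\<pi> (r n)) z) \<longlonglongrightarrow> l z"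
    by metis
  have rows: "((\<lambda>j. pmf (\<pi> n) (i, j)) has_sum pmf p i) UNIV" for n i
    using pmf_map_fst_has_sum[of "\<pi> n" i] \<pi>[of n] by (simp add: pmf_couplings_def)
  have cols: "((\<lambda>i. pmf (\<pi> n) (i, j)) has_sum pmf q j) UNIV" for n j
    using pmf_map_snd_has_sum[of "\<pi> n" j] \<pi>[of n] by (simp add: pmf_couplings_def)
  have le_p: "pmf (\<pi> n) (i, j) \<le> pmf p i" for n i j
    using finite_sum_le_has_sum[OF rows, of "{j}"] by simp
  have le_q: "pmf (\<pi> n) (i, j) \<le> pmf q j" for n i j
    using finite_sum_le_has_sum[OF cols, of "{i}"] by simp
  have summable: "pmf p summable_on UNIV" "pmf q summable_on UNIV"
    using pmf_has_sum_1 by (auto simp: has_sum_iff)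
  obtain \<rho> where "\<rho> \<in> pmf_couplings p q" "pmf \<rho> = l"
  proof (rule pmf_coupling_exists)
    show "l z \<ge> 0" for z
      using l by (rule LIMSEQ_le_const) auto
    \<comment> \<open>A row sums to a value of \<open>pmf p\<close> but is dominated by
      \<open>pmf q\<close>, which is summable in \<open>j\<close>; for columns the roles are
      exchanged.\<close>
    show "((\<lambda>j. l (i, j)) has_sum pmf p i) UNIV" for i
      by (rule has_sum_limit_dominated[OF l rows _ le_q summable(2)]) auto
    show "((\<lambda>i. l (i, j)) has_sum pmf q j) UNIV" for j
      by (rule has_sum_limit_dominated[OF l cols _ le_p summable(1)]) auto
  qed
  with r l that show ?thesis by simp
qed

section \<open>Lower semicontinuity of the cost and existence of optimal couplings\<close>

lemma nn_integral_pmf_le_iff: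
  assumes "\<And>z. c z \<ge> 0" "v \<ge> 0"
  shows "(\<integral>\<^sup>+z. ennreal (c z) \<partial>measure_pmf \<pi>) \<le> ennreal v \<longleftrightarrow>
    (\<forall>F. finite F \<longrightarrow> (\<Sum>z\<in>F. pmf \<pi> z * c z) \<le> v)"
proof -
  have "(\<integral>\<^sup>+z. ennreal (c z) \<partial>measure_pmf \<pi>) = (\<integral>\<^sup>+z. ennreal (pmf \<pi> z * c z) \<partial>count_space UNIV)"
    using assms(1) by (simp add: nn_integral_measure_pmf ennreal_mult)
  then show ?thesis
    using assms nn_integral_count_space_le_iff[of "\<lambda>z. pmf \<pi> z * c z" v] by simp
qed

text \<open>A Fatou argument on finite partial sums. Cost and bound may both vary with
  \<open>n\<close>, which covers minimising sequences as well as truncated costs.\<close>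

lemma nn_integral_pmf_lsc:
  assumes \<rho>: "\<And>z. (\<lambda>n. pmf (\<pi> n) z) \<longlonglongrightarrow> pmf \<rho> z"
    and c: "\<And>z. (\<lambda>n. c n z) \<longlonglongrightarrow> d z" "\<And>n z. c n z \<ge> 0"
    and v: "v \<longlonglongrightarrow> w" "\<And>n. v n \<ge> 0"
    and le: "\<And>n. (\<integral>\<^sup>+z. ennreal (c n z) \<partial>measure_pmf (\<pi> n)) \<le> ennreal (v n)"
  shows "(\<integral>\<^sup>+z. ennreal (d z) \<partial>measure_pmf \<rho>) \<le> ennreal w"
proof -
  have d: "d z \<ge> 0" for z
    using c by (intro LIMSEQ_le_const[OF c(1)]) auto
  have w: "w \<ge> 0"
    using v by (intro LIMSEQ_le_const[OF v(1)]) auto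
  have "(\<Sum>z\<in>F. pmf \<rho> z * d z) \<le> w" if "finite F" for F
  proof (rule LIMSEQ_le)
    show "(\<lambda>n. \<Sum>z\<in>F. pmf (\<pi> n) z * c n z) \<longlonglongrightarrow> (\<Sum>z\<in>F. pmf \<rho> z * d z)"
      by (intro tendsto_intros \<rho> c)
    show "v \<longlonglongrightarrow> w" by fact
    have "(\<Sum>z\<in>F. pmf (\<pi> n) z * c n z) \<le> v n" for n
      using le[of n] that nn_integral_pmf_le_iff[of "c n" "v n" "\<pi> n"] c(2) v(2) by simp
    then show "\<exists>N. \<forall>n\<ge>N. (\<Sum>z\<in>F. pmf (\<pi> n) z * c n z) \<le> v n"
      by simp
  qed
  with d w show ?thesis
    by (simp add: nn_integral_pmf_le_iff)
qed

lemma pmf_couplings_nonempty: "pair_pmf p q \<in> pmf_couplings p q"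
  by (simp add: pmf_couplings_def map_fst_pair_pmf map_snd_pair_pmf)

text \<open>The direct method: a minimising sequence has a convergent subsequence, and lower
  semicontinuity makes its limit a minimiser. With the product coupling as competitor, the bound
  \<open>R\<close> keeps the infimum finite.\<close>

lemma optimal_pmf_coupling_exists:
  fixes p :: "'i::countable pmf" and q :: "'j::countable pmf"
  assumes c: "\<And>z. 0 \<le> c z" "\<And>z. c z \<le> R"
  obtains \<rho> where "\<rho> \<in> pmf_couplings p q"
    "\<And>\<pi>. \<pi> \<in> pmf_couplings p q \<Longrightarrow>
      (\<integral>\<^sup>+z. ennreal (c z) \<partial>measure_pmf \<rho>) \<le> (\<integral>\<^sup>+z. ennreal (c z) \<partial>measure_pmf \<pi>)"
proof -
  define V where "V = (INF \<pi>\<in>pmf_couplings p q. \<integral>\<^sup>+z. ennreal (c z) \<partial>measure_pmf \<pi>)"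
  have "V \<le> (\<integral>\<^sup>+z. ennreal (c z) \<partial>measure_pmf (pair_pmf p q))"
    unfolding V_def using pmf_couplings_nonempty by (rule INF_lower)
  also have "\<dots> \<le> (\<integral>\<^sup>+z. ennreal R \<partial>measure_pmf (pair_pmf p q))"
    using c by (intro nn_integral_mono ennreal_leI) auto
  also have "\<dots> < top" by simp
  finally obtain v where v: "V = ennreal v" "v \<ge> 0"
    by (cases V) auto
  have "\<exists>\<pi>\<in>pmf_couplings p q. (\<integral>\<^sup>+z. ennreal (c z) \<partial>measure_pmf \<pi>) < ennreal (v + 1 / real (Suc n))" for n
    using v by (subst INF_less_iff[symmetric], fold V_def) (simp add: ennreal_less_iff)
  then obtain \<pi> where \<pi>: "\<And>n. \<pi> n \<in> pmf_couplings p q"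
    "\<And>n. (\<integral>\<^sup>+z. ennreal (c z) \<partial>measure_pmf (\<pi> n)) < ennreal (v + 1 / real (Suc n))"
    by metis
  obtain r \<rho> where r: "strict_mono r" and \<rho>: "\<rho> \<in> pmf_couplings p q"
    and lim: "\<And>z. (\<lambda>n. pmf (\<pi> (r n)) z) \<longlonglongrightarrow> pmf \<rho> z"
    using pmf_couplings_seq_compact[of \<pi>, OF \<pi>(1)] by metis
  have "(\<lambda>n. v + 1 / real (Suc n)) \<longlonglongrightarrow> v"
    using LIMSEQ_inverse_real_of_nat_add[of v] by (simp add: inverse_eq_divide)
  then have "(\<lambda>n. v + 1 / real (Suc (r n))) \<longlonglongrightarrow> v"
    using r by (auto dest: LIMSEQ_subseq_LIMSEQ simp: o_def)
  then have "(\<integral>\<^sup>+z. ennreal (c z) \<partial>measure_pmf \<rho>) \<le> ennreal v"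
  proof (rule nn_integral_pmf_lsc[where c="\<lambda>_. c", rotated 3])
    show "(\<integral>\<^sup>+z. ennreal (c z) \<partial>measure_pmf (\<pi> (r n))) \<le> ennreal (v + 1 / real (Suc (r n)))" for n
      using \<pi>(2) by (rule less_imp_le)
  qed (use lim c v in auto)
  also note v(1)[symmetric]
  finally have "(\<integral>\<^sup>+z. ennreal (c z) \<partial>measure_pmf \<rho>) \<le> (\<integral>\<^sup>+z. ennreal (c z) \<partial>measure_pmf \<pi>)"
    if "\<pi> \<in> pmf_couplings p q" for \<pi>
    unfolding V_def by (rule order_trans) (use that in \<open>rule INF_lower\<close>)
  with \<rho> that show ?thesis by blast
qed

text \<open>First variation at the optimum: for small \<delta> > 0 the array
  \<open>pmf \<rho> + \<delta> * h\<close> is again a coupling. Its marginals are unchanged, and it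
  stays nonnegative because \<open>h\<close> has finite support and is negative only where \<rho>
  has mass. Comparing costs gives \<open>\<delta> * v \<ge> 0\<close>.\<close>

lemma optimal_coupling_perturbation_nonneg:
  assumes c: "\<And>z. 0 \<le> c z" "\<And>z. c z \<le> R"
    and \<rho>: "\<rho> \<in> pmf_couplings p q"
    and opt: "\<And>\<pi>. \<pi> \<in> pmf_couplings p q \<Longrightarrow>
      (\<integral>\<^sup>+z. ennreal (c z) \<partial>measure_pmf \<rho>) \<le> (\<integral>\<^sup>+z. ennreal (c z) \<partial>measure_pmf \<pi>)"
    and h: "finite {z. h z \<noteq> 0}" "\<And>z. h z < 0 \<Longrightarrow> z \<in> set_pmf \<rho>"
    and rows: "\<And>i. ((\<lambda>j. h (i, j)) has_sum 0) UNIV"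
    and cols: "\<And>j. ((\<lambda>i. h (i, j)) has_sum 0) UNIV"
    and cost: "((\<lambda>z. h z * c z) has_sum v) UNIV"
  shows "v \<ge> 0"
proof -
  have "\<forall>\<^sub>F \<delta> in at_right 0. pmf \<rho> z + \<delta> * h z \<ge> 0" for z
  proof (cases "h z < 0")
    case True
    have "((\<lambda>\<delta>. pmf \<rho> z + \<delta> * h z) \<longlongrightarrow> pmf \<rho> z + 0 * h z) (at_right 0)"
      by (intro tendsto_intros)
    then have "\<forall>\<^sub>F \<delta> in at_right 0. 0 < pmf \<rho> z + \<delta> * h z"
      by (rule order_tendstoD) (use h(2)[OF True] in \<open>simp add: pmf_positive\<close>)
    then show ?thesis by eventually_elim simp
  next
    case False
    have "\<forall>\<^sub>F \<delta> in at_right 0. \<delta> > (0::real)"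
      by (simp add: eventually_at_right_less)
    then show ?thesis by eventually_elim (use False in auto)
  qed
  then have "\<forall>\<^sub>F \<delta> in at_right 0. \<forall>z\<in>{z. h z \<noteq> 0}. pmf \<rho> z + \<delta> * h z \<ge> 0"
    using h(1) by (intro eventually_ball_finite) auto
  moreover have "\<forall>\<^sub>F \<delta> in at_right 0. \<delta> > (0::real)"
    by (simp add: eventually_at_right_less)
  ultimately have "\<forall>\<^sub>F \<delta> in at_right 0. \<delta> > 0 \<and> (\<forall>z\<in>{z. h z \<noteq> 0}. pmf \<rho> z + \<delta> * h z \<ge> 0)"
    by eventually_elim auto
  then obtain \<delta> where \<delta>: "\<delta> > 0" and \<delta>_h: "\<forall>z\<in>{z. h z \<noteq> 0}. pmf \<rho> z + \<delta> * h z \<ge> 0"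
    by (metis (lifting) eventually_happens trivial_limit_at_right_real)
  have nonneg: "pmf \<rho> z + \<delta> * h z \<ge> 0" for z
  proof (cases "h z = 0")
    case False
    then show ?thesis using \<delta>_h by blast
  qed simp
  have rows': "((\<lambda>j. pmf \<rho> (i, j) + \<delta> * h (i, j)) has_sum pmf p i) UNIV" for i
    using has_sum_add[OF pmf_map_fst_has_sum[of \<rho> i] has_sum_cmult_right[OF rows[of i], of \<delta>]] \<rho>
    by (simp add: pmf_couplings_def)
  have cols': "((\<lambda>i. pmf \<rho> (i, j) + \<delta> * h (i, j)) has_sum pmf q j) UNIV" for j
    using has_sum_add[OF pmf_map_snd_has_sum[of \<rho> j] has_sum_cmult_right[OF cols[of j], of \<delta>]] \<rho>
    by (simp add: pmf_couplings_def)
  obtain \<pi> where \<pi>: "\<pi> \<in> pmf_couplings p q" "pmf \<pi> = (\<lambda>z. pmf \<rho> z + \<delta> * h z)"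
    by (rule pmf_coupling_exists[OF nonneg rows' cols'])
  have "(\<integral>\<^sup>+z. ennreal (c z) \<partial>measure_pmf \<rho>) \<le> (\<integral>\<^sup>+z. ennreal R \<partial>measure_pmf \<rho>)"
    using c by (intro nn_integral_mono ennreal_leI) auto
  also have "\<dots> < top" by simp
  finally obtain V where V: "(\<integral>\<^sup>+z. ennreal (c z) \<partial>measure_pmf \<rho>) = ennreal V" "V \<ge> 0"
    by (cases "\<integral>\<^sup>+z. ennreal (c z) \<partial>measure_pmf \<rho>") auto
  have "((\<lambda>z. pmf \<rho> z * c z) has_sum V) UNIV"
    using V c by (simp add: nn_integral_measure_pmf nn_integral_count_space_has_sum_iff flip: ennreal_mult)
  then have "((\<lambda>z. pmf \<rho> z * c z + \<delta> * (h z * c z)) has_sum (V + \<delta> * v)) UNIV"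
    by (intro has_sum_add has_sum_cmult_right cost)
  then have *: "((\<lambda>z. pmf \<pi> z * c z) has_sum (V + \<delta> * v)) UNIV"
    by (simp add: \<pi>(2) algebra_simps)
  \<comment> \<open>The sign must be known before moving to \<open>ennreal\<close>, which collapses
    negative reals to 0.\<close>
  moreover have **: "V + \<delta> * v \<ge> 0"
    using c by (intro has_sum_nonneg[OF *]) auto
  ultimately have "(\<integral>\<^sup>+z. ennreal (c z) \<partial>measure_pmf \<pi>) = ennreal (V + \<delta> * v)"
    using c by (simp add: nn_integral_measure_pmf nn_integral_count_space_has_sum_iff flip: ennreal_mult)
  then have "V \<le> V + \<delta> * v"
    using opt[OF \<pi>(1)] V ** by simp
  with \<delta> show ?thesis by (simp add: zero_le_mult_iff)
qed

subsection \<open>Potentials on countable sets\<close>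

text \<open>The chains of Rockafellar's construction of a potential. The real argument accumulates
  the change of cost; only it and the current endpoint are kept, not the list of visited
  pairs.\<close>

inductive transport_chain :: "('i \<Rightarrow> 'j \<Rightarrow> real) \<Rightarrow> ('i \<times> 'j) set \<Rightarrow> 'i \<Rightarrow> real \<Rightarrow> 'i \<Rightarrow> bool"
  for c \<Gamma> i\<^sub>0 where
  start: "transport_chain c \<Gamma> i\<^sub>0 0 i\<^sub>0"
| step: "transport_chain c \<Gamma> i\<^sub>0 v i \<Longrightarrow> (i, j) \<in> \<Gamma> \<Longrightarrow> transport_chain c \<Gamma> i\<^sub>0 (v - c i j + c a j) a"

lemma has_sum_unit: "((\<lambda>x. of_bool (x = a) * f x) has_sum (f a :: real)) UNIV"
  by (rule has_sum_finite_neutralI[where B="{a}"]) auto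

text \<open>
  Along a chain, mass is moved off the pairs \<open>(i, j)\<close> in the support and onto the pairs \<open>(a, j)\<close>. The
  resulting perturbation \<open>h\<close> of the coupling has vanishing second marginal, and its first
  marginal only sees the two ends of the chain.
\<close>

lemma transport_chain_perturbation:
  assumes "transport_chain c \<Gamma> i\<^sub>0 v a"
  shows "\<exists>h. finite {z. h z \<noteq> 0} \<and> (\<forall>z. h z < 0 \<longrightarrow> z \<in> \<Gamma>) \<and>
    (\<forall>i. ((\<lambda>j. h (i, j)) has_sum (of_bool (i = a) - of_bool (i = i\<^sub>0))) UNIV) \<and>
    (\<forall>j. ((\<lambda>i. h (i, j)) has_sum (0::real)) UNIV) \<and>
    ((\<lambda>z. h z * c (fst z) (snd z)) has_sum v) UNIV"
  using assms
proof induction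
  case start
  show ?case by (rule exI[of _ "\<lambda>_. 0"]) auto
next
  case (step v i j a)
  then obtain h where h: "finite {z. h z \<noteq> 0}" "\<And>z. h z < 0 \<Longrightarrow> z \<in> \<Gamma>"
    and rows: "\<And>k. ((\<lambda>j. h (k, j)) has_sum (of_bool (k = i) - of_bool (k = i\<^sub>0))) UNIV"
    and cols: "\<And>j. ((\<lambda>i. h (i, j)) has_sum 0) UNIV"
    and cost: "((\<lambda>z. h z * c (fst z) (snd z)) has_sum v) UNIV"
    by blast
  define h' where "h' z = h z - of_bool (z = (i, j)) + of_bool (z = (a, j))" for z
  have "{z. h' z \<noteq> 0} \<subseteq> {z. h z \<noteq> 0} \<union> {(i, j), (a, j)}"
    by (auto simp: h'_def)
  then have "finite {z. h' z \<noteq> 0}"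
    using h(1) finite_subset by blast
  moreover have "\<forall>z. h' z < 0 \<longrightarrow> z \<in> \<Gamma>"
    using h(2) step.hyps by (auto simp: h'_def of_bool_def not_less split: if_splits)
  moreover have "((\<lambda>l. h' (k, l)) has_sum (of_bool (k = a) - of_bool (k = i\<^sub>0))) UNIV" for k
  proof -
    have "((\<lambda>l. h (k, l) + (of_bool (l = j) * - of_bool (k = i) + of_bool (l = j) * of_bool (k = a)))
      has_sum (of_bool (k = i) - of_bool (k = i\<^sub>0) + (- of_bool (k = i) + of_bool (k = a)))) UNIV"
      by (intro has_sum_add has_sum_unit rows)
    also have "(\<lambda>l. h (k, l) + (of_bool (l = j) * - of_bool (k = i) + of_bool (l = j) * of_bool (k = a))) =
      (\<lambda>l. h' (k, l))"
      by (auto simp: h'_def)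
    finally show ?thesis by (simp add: algebra_simps)
  qed
  moreover have "((\<lambda>k. h' (k, l)) has_sum 0) UNIV" for l
  proof -
    have "((\<lambda>k. h (k, l) + (of_bool (k = i) * - of_bool (l = j) + of_bool (k = a) * of_bool (l = j)))
      has_sum (0 + (- of_bool (l = j) + of_bool (l = j)))) UNIV"
      by (intro has_sum_add has_sum_unit cols)
    also have "(\<lambda>k. h (k, l) + (of_bool (k = i) * - of_bool (l = j) + of_bool (k = a) * of_bool (l = j))) =
      (\<lambda>k. h' (k, l))"
      by (auto simp: h'_def)
    finally show ?thesis by simp
  qed
  moreover have "((\<lambda>z. h' z * c (fst z) (snd z)) has_sum (v - c i j + c a j)) UNIV"
  proof -
    have "((\<lambda>z. h z * c (fst z) (snd z) +
        (of_bool (z = (i, j)) * - c (fst z) (snd z) + of_bool (z = (a, j)) * c (fst z) (snd z)))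
      has_sum (v + (- c (fst (i, j)) (snd (i, j)) + c (fst (a, j)) (snd (a, j))))) UNIV"
      by (intro has_sum_add has_sum_unit cost)
    also have "(\<lambda>z. h z * c (fst z) (snd z) +
        (of_bool (z = (i, j)) * - c (fst z) (snd z) + of_bool (z = (a, j)) * c (fst z) (snd z))) =
      (\<lambda>z. h' z * c (fst z) (snd z))"
      by (auto simp: h'_def algebra_simps)
    finally show ?thesis by (simp add: algebra_simps)
  qed
  ultimately show ?case
    by (intro exI[of _ h'] conjI allI) auto
qed

text \<open>Distinct indices at distance 0 must be allowed: the cost will be
  \<open>dist (a i) (a j)\<close> along a dense sequence that may repeat points.\<close>

locale pseudometric =
  fixes c :: "'i \<Rightarrow> 'i \<Rightarrow> real"
  assumes nonneg: "c i j \<ge> 0" and refl [simp]: "c i i = 0" and sym: "c i j = c j i"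
    and triangle: "c i k \<le> c i j + c j k"

text \<open>Rockafellar's construction: \<open>f a\<close> is the least cost of a chain from
  \<open>i\<^sub>0\<close> to \<open>a\<close>. The hypothesis on closed chains is cyclical
  monotonicity and keeps the infimum finite; the triangle inequality lets one function serve on both
  sides.\<close>

lemma (in pseudometric) transport_chain_potential:
  assumes closed: "\<And>v. transport_chain c \<Gamma> i\<^sub>0 v i\<^sub>0 \<Longrightarrow> v \<ge> 0" and \<Gamma>: "(i\<^sub>0, j\<^sub>0) \<in> \<Gamma>"
  obtains f where "\<And>i j. f i - f j \<le> c i j" "\<And>i j. (i, j) \<in> \<Gamma> \<Longrightarrow> f i - f j = c i j"
proof -
  define f where "f a = Inf {v. transport_chain c \<Gamma> i\<^sub>0 v a}" for a
  \<comment> \<open>Redirecting the last move to \<open>i\<^sub>0\<close> closes the chain, at an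
    extra cost of at most \<open>c a i\<^sub>0\<close>.\<close>
  have lower: "v \<ge> - c a i\<^sub>0" if "transport_chain c \<Gamma> i\<^sub>0 v a" for v a
    using that
  proof cases
    case start
    then show ?thesis by simp
  next
    case (step w i j)
    have "w - c i j + c i\<^sub>0 j \<ge> 0"
      using transport_chain.step[OF step(2,3)] closed by blast
    with step(1) triangle[of i\<^sub>0 j a] sym[of a i\<^sub>0] show ?thesis by simp
  qed
  have f_le: "f a \<le> v" if "transport_chain c \<Gamma> i\<^sub>0 v a" for v a
    unfolding f_def by (rule cInf_lower) (use that lower in \<open>auto intro!: bdd_belowI\<close>)
  \<comment> \<open>One move through \<open>(i\<^sub>0, j\<^sub>0)\<close> reaches every endpoint,
    so no infimum is over the empty set.\<close>
  have ex: "transport_chain c \<Gamma> i\<^sub>0 (0 - c i\<^sub>0 j\<^sub>0 + c b j\<^sub>0) b" for b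
    using start \<Gamma> by (rule transport_chain.step)
  \<comment> \<open>The chain is not lengthened: its last move is redirected from \<open>a\<close>
    to \<open>b\<close>. The trivial chain has no last move and is replaced by the one-move chain
    \<open>ex\<close>.\<close>
  have extend: "f b \<le> v + c a b" if "transport_chain c \<Gamma> i\<^sub>0 v a" for v a b
    using that
  proof cases
    case start
    then show ?thesis
      using f_le[OF ex, of b] triangle[of b j\<^sub>0 i\<^sub>0] sym[of b i\<^sub>0] by simp
  next
    case (step w i j)
    have "f b \<le> w - c i j + c b j"
      using transport_chain.step[OF step(2,3)] by (rule f_le)
    with step(1) triangle[of b j a] sym[of b a] show ?thesis by simp
  qed
  have lip: "f b - f a \<le> c a b" for a b
  proof -
    have "f b - c a b \<le> f a"
      unfolding f_def[of a]
      by (rule cInf_greatest) (use ex extend in \<open>auto simp: algebra_simps\<close>)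
    then show ?thesis by simp
  qed
  have "f j + c i j \<le> f i" if "(i, j) \<in> \<Gamma>" for i j
    unfolding f_def[of i]
  proof (rule cInf_greatest)
    fix v assume "v \<in> {v. transport_chain c \<Gamma> i\<^sub>0 v i}"
    \<comment> \<open>The move through \<open>(i, j)\<close> ends at \<open>j\<close> itself, so the
      added cost \<open>c j j\<close> vanishes.\<close>
    then have "f j \<le> v - c i j + c j j"
      using that by (intro f_le transport_chain.step) auto
    then show "f j + c i j \<le> v" by simp
  qed (use ex in auto)
  with lip sym have "f i - f j = c i j" if "(i, j) \<in> \<Gamma>" for i j
    using that lip[of i j] sym[of i j] by (smt (verit))
  with lip sym that show ?thesis by metis
qed

text \<open>Complementary slackness: the potential is tight on the support of an optimal coupling,
  so the optimal cost equals the difference of its expectations, which \<open>dual\<close> bounds by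
  \<open>S\<close>.\<close>

lemma bounded_duality_pmf:
  fixes p q :: "'i::countable pmf"
  assumes "pseudometric c"
    and bounded: "\<And>i j. c i j \<le> R"
    and dual: "\<And>f B. (\<And>i. \<bar>f i\<bar> \<le> B) \<Longrightarrow> (\<And>i j. f i - f j \<le> c i j) \<Longrightarrow>
      measure_pmf.expectation p f - measure_pmf.expectation q f \<le> S"
  obtains \<rho> where "\<rho> \<in> pmf_couplings p q"
    "(\<integral>\<^sup>+z. ennreal (c (fst z) (snd z)) \<partial>measure_pmf \<rho>) \<le> ennreal S"
proof -
  interpret pseudometric c by fact
  let ?c = "\<lambda>z. c (fst z) (snd z)"
  obtain \<rho> where \<rho>: "\<rho> \<in> pmf_couplings p q" and opt: "\<And>\<pi>. \<pi> \<in> pmf_couplings p q \<Longrightarrow>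
      (\<integral>\<^sup>+z. ennreal (?c z) \<partial>measure_pmf \<rho>) \<le> (\<integral>\<^sup>+z. ennreal (?c z) \<partial>measure_pmf \<pi>)"
    by (rule optimal_pmf_coupling_exists[of ?c R p q]) (use nonneg bounded in auto)
  obtain i\<^sub>0 j\<^sub>0 where "(i\<^sub>0, j\<^sub>0) \<in> set_pmf \<rho>"
    using set_pmf_not_empty[of \<rho>] by auto
  then obtain f where lip: "\<And>i j. f i - f j \<le> c i j"
    and tight: "\<And>i j. (i, j) \<in> set_pmf \<rho> \<Longrightarrow> f i - f j = c i j"
  proof (rule transport_chain_potential[rotated])
    \<comment> \<open>For a closed chain the two ends cancel in the first marginal, so the
      perturbation preserves both marginals and optimality applies.\<close>
    fix v assume "transport_chain c (set_pmf \<rho>) i\<^sub>0 v i\<^sub>0"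
    from transport_chain_perturbation[OF this] show "v \<ge> 0"
      by (elim exE conjE)
        (rule optimal_coupling_perturbation_nonneg[of ?c R \<rho> p q], use nonneg bounded \<rho> opt in auto)
  qed blast
  \<comment> \<open>The bounded cost makes the potential bounded, hence an admissible test
    function.\<close>
  have f_bd: "\<bar>f i\<bar> \<le> \<bar>f i\<^sub>0\<bar> + R" for i
    using lip[of i i\<^sub>0] lip[of i\<^sub>0 i] bounded[of i i\<^sub>0] bounded[of i\<^sub>0 i] by linarith
  have int: "integrable (measure_pmf M) (\<lambda>x. f (g x))" for M :: "('i \<times> 'i) pmf" and g
    by (rule measure_pmf.integrable_const_bound[where B="\<bar>f i\<^sub>0\<bar> + R"]) (use f_bd in auto)
  have "measure_pmf.expectation p f - measure_pmf.expectation q f =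
      measure_pmf.expectation \<rho> (\<lambda>z. f (fst z) - f (snd z))"
    using \<rho> int by (auto simp: pmf_couplings_def)
  also have "\<dots> = measure_pmf.expectation \<rho> ?c"
    by (intro integral_cong_AE) (auto simp: AE_measure_pmf_iff tight)
  finally have "measure_pmf.expectation \<rho> ?c \<le> S"
    using dual[OF f_bd lip] by simp
  moreover have "(\<integral>\<^sup>+z. ennreal (?c z) \<partial>measure_pmf \<rho>) = ennreal (measure_pmf.expectation \<rho> ?c)"
    by (intro nn_integral_eq_integral measure_pmf.integrable_const_bound[where B=R])
      (use nonneg bounded in auto)
  ultimately show ?thesis
    using \<rho> that by (simp add: ennreal_leI)
qed

text \<open>The cost is truncated at \<open>n\<close>: this keeps the triangle inequality, and test
  functions for the truncated cost are admissible for \<open>c\<close>. The couplings found for each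
  \<open>n\<close> share the bound \<open>S\<close>, which their limit inherits.\<close>

theorem duality_pmf:
  fixes p q :: "'i::countable pmf"
  assumes "pseudometric c"
    and dual: "\<And>f B. (\<And>i. \<bar>f i\<bar> \<le> B) \<Longrightarrow> (\<And>i j. f i - f j \<le> c i j) \<Longrightarrow>
      measure_pmf.expectation p f - measure_pmf.expectation q f \<le> S"
  obtains \<rho> where "\<rho> \<in> pmf_couplings p q"
    "(\<integral>\<^sup>+z. ennreal (c (fst z) (snd z)) \<partial>measure_pmf \<rho>) \<le> ennreal S"
proof -
  interpret pseudometric c by fact
  let ?c = "\<lambda>n z. min (real n) (c (fst z) (snd z))"
  have S: "S \<ge> 0"
    using dual[of "\<lambda>_. 0" 0] nonneg by simp
  have "\<exists>\<pi>\<in>pmf_couplings p q. (\<integral>\<^sup>+z. ennreal (?c n z) \<partial>measure_pmf \<pi>) \<le> ennreal S" for n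
  proof -
    interpret truncated: pseudometric "\<lambda>i j. min (real n) (c i j)"
    proof
      show "min (real n) (c i k) \<le> min (real n) (c i j) + min (real n) (c j k)" for i j k
        using nonneg[of i j] nonneg[of j k] triangle[of i k j] by (auto simp: min_def)
    qed (use nonneg sym in auto)
    obtain \<rho> where "\<rho> \<in> pmf_couplings p q" "(\<integral>\<^sup>+z. ennreal (?c n z) \<partial>measure_pmf \<rho>) \<le> ennreal S"
      by (rule bounded_duality_pmf[OF truncated.pseudometric_axioms, of "real n" p q S]) (auto intro!: dual)
    then show ?thesis by blast
  qed
  then obtain \<pi> where \<pi>: "\<And>n. \<pi> n \<in> pmf_couplings p q"
    "\<And>n. (\<integral>\<^sup>+z. ennreal (?c n z) \<partial>measure_pmf (\<pi> n)) \<le> ennreal S"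
    by metis
  obtain r \<rho> where r: "strict_mono r" and \<rho>: "\<rho> \<in> pmf_couplings p q"
    and lim: "\<And>z. (\<lambda>n. pmf (\<pi> (r n)) z) \<longlonglongrightarrow> pmf \<rho> z"
    using pmf_couplings_seq_compact[of \<pi>, OF \<pi>(1)] by metis
  have c_lim: "(\<lambda>n. ?c (r n) z) \<longlonglongrightarrow> c (fst z) (snd z)" for z
  proof (rule tendsto_eventually)
    obtain N where "c (fst z) (snd z) \<le> real N"
      using real_arch_simple by blast
    then have "?c (r n) z = c (fst z) (snd z)" if "n \<ge> N" for n
      using seq_suble[OF r, of n] that by (simp add: min_def)
    then show "\<forall>\<^sub>F n in sequentially. ?c (r n) z = c (fst z) (snd z)"
      by (rule eventually_sequentiallyI)
  qed
  have "(\<integral>\<^sup>+z. ennreal (c (fst z) (snd z)) \<partial>measure_pmf \<rho>) \<le> ennreal S"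
  proof (rule nn_integral_pmf_lsc[where c="\<lambda>n. ?c (r n)", rotated 3])
    show "(\<integral>\<^sup>+z. ennreal (?c (r n) z) \<partial>measure_pmf (\<pi> (r n))) \<le> ennreal S" for n
      by (rule \<pi>(2))
  qed (use lim c_lim nonneg S in auto)
  with \<rho> that show ?thesis by blast
qed

subsection \<open>Kantorovich--Rubinstein duality on Polish spaces\<close>

lemma pmf_le_pmf_map_fst: "pmf \<rho> (i, j) \<le> pmf (map_pmf fst \<rho>) i"
  using finite_sum_le_has_sum[OF pmf_map_fst_has_sum[of \<rho> i], of "{j}"] by simp

lemma pmf_le_pmf_map_snd: "pmf \<rho> (i, j) \<le> pmf (map_pmf snd \<rho>) j"
  using finite_sum_le_has_sum[OF pmf_map_snd_has_sum[of \<rho> j], of "{i}"] by simp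

text \<open>The Radon-Nikodym density of \<rho> with respect to the product of its marginals.
  Division by zero yields 0 where a marginal vanishes, and there \<rho> vanishes too.\<close>

definition relative_density :: "('i \<times> 'j) pmf \<Rightarrow> 'i \<Rightarrow> 'j \<Rightarrow> ennreal" where
  "relative_density \<rho> i j =
    ennreal (pmf \<rho> (i, j) / (pmf (map_pmf fst \<rho>) i * pmf (map_pmf snd \<rho>) j))"

text \<open>Integrating to 1 in one variable is what will leave the other marginal unchanged after
  reweighting a product law.\<close>

lemma relative_density_fst:
  assumes i: "pmf (map_pmf fst \<rho>) i \<noteq> 0"
  shows "(\<integral>\<^sup>+j. relative_density \<rho> i j \<partial>measure_pmf (map_pmf snd \<rho>)) = 1"
proof -
  have "(\<integral>\<^sup>+j. relative_density \<rho> i j \<partial>measure_pmf (map_pmf snd \<rho>)) =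
      (\<integral>\<^sup>+j. ennreal (1 / pmf (map_pmf fst \<rho>) i * pmf \<rho> (i, j)) \<partial>count_space UNIV)"
    unfolding nn_integral_measure_pmf
  proof (rule nn_integral_cong)
    fix j
    show "ennreal (pmf (map_pmf snd \<rho>) j) * relative_density \<rho> i j =
      ennreal (1 / pmf (map_pmf fst \<rho>) i * pmf \<rho> (i, j))"
      using pmf_le_pmf_map_snd[of \<rho> i j]
      by (cases "pmf (map_pmf snd \<rho>) j = 0")
        (auto simp: relative_density_def ennreal_mult[symmetric] field_simps)
  qed
  also have "\<dots> = ennreal 1"
    using has_sum_cmult_right[OF pmf_map_fst_has_sum[of \<rho> i], of "1 / pmf (map_pmf fst \<rho>) i"] i
    by (subst nn_integral_count_space_has_sum_iff) auto
  finally show ?thesis by simp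
qed

lemma relative_density_snd:
  assumes j: "pmf (map_pmf snd \<rho>) j \<noteq> 0"
  shows "(\<integral>\<^sup>+i. relative_density \<rho> i j \<partial>measure_pmf (map_pmf fst \<rho>)) = 1"
proof -
  have "(\<integral>\<^sup>+i. relative_density \<rho> i j \<partial>measure_pmf (map_pmf fst \<rho>)) =
      (\<integral>\<^sup>+i. ennreal (1 / pmf (map_pmf snd \<rho>) j * pmf \<rho> (i, j)) \<partial>count_space UNIV)"
    unfolding nn_integral_measure_pmf
  proof (rule nn_integral_cong)
    fix i
    show "ennreal (pmf (map_pmf fst \<rho>) i) * relative_density \<rho> i j =
      ennreal (1 / pmf (map_pmf snd \<rho>) j * pmf \<rho> (i, j))"
      using pmf_le_pmf_map_fst[of \<rho> i j]
      by (cases "pmf (map_pmf fst \<rho>) i = 0")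
        (auto simp: relative_density_def ennreal_mult[symmetric] field_simps)
  qed
  also have "\<dots> = ennreal 1"
    using has_sum_cmult_right[OF pmf_map_snd_has_sum[of \<rho> j], of "1 / pmf (map_pmf snd \<rho>) j"] j
    by (subst nn_integral_count_space_has_sum_iff) auto
  finally show ?thesis by simp
qed

lemma nn_integral_relative_density:
  "(\<integral>\<^sup>+i. \<integral>\<^sup>+j. relative_density \<rho> i j * g (i, j) \<partial>measure_pmf (map_pmf snd \<rho>)
      \<partial>measure_pmf (map_pmf fst \<rho>)) = (\<integral>\<^sup>+z. g z \<partial>measure_pmf \<rho>)"
proof -
  have *: "ennreal (pmf (map_pmf fst \<rho>) i) * (ennreal (pmf (map_pmf snd \<rho>) j) * (relative_density \<rho> i j * g (i, j))) =
      ennreal (pmf \<rho> (i, j)) * g (i, j)" for i j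
    using pmf_le_pmf_map_fst[of \<rho> i j] pmf_le_pmf_map_snd[of \<rho> i j]
    by (cases "pmf (map_pmf fst \<rho>) i = 0"; cases "pmf (map_pmf snd \<rho>) j = 0")
      (auto simp: relative_density_def ennreal_mult[symmetric] mult.assoc[symmetric])
  have "(\<integral>\<^sup>+i. \<integral>\<^sup>+j. relative_density \<rho> i j * g (i, j) \<partial>measure_pmf (map_pmf snd \<rho>)
      \<partial>measure_pmf (map_pmf fst \<rho>)) =
    (\<integral>\<^sup>+i. \<integral>\<^sup>+j. ennreal (pmf \<rho> (i, j)) * g (i, j) \<partial>count_space UNIV \<partial>count_space UNIV)"
    unfolding nn_integral_measure_pmf *[symmetric]
    by (intro nn_integral_cong nn_integral_cmult[symmetric]) auto
  also have "\<dots> = (\<integral>\<^sup>+z. g z \<partial>measure_pmf \<rho>)"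
    by (simp add: nn_integral_measure_pmf nn_integral_fst_count_space[where f="\<lambda>z. ennreal (pmf \<rho> z) * g z"])
  finally show ?thesis .
qed

lemma pmf_of_countable_distr:
  fixes T :: "'a \<Rightarrow> 'i::countable"
  assumes "prob_space M" and T: "T \<in> measurable M (count_space UNIV)"
  obtains p where "measure_pmf p = distr M (count_space UNIV) T"
proof -
  interpret D: prob_space "distr M (count_space UNIV) T"
    using assms by (rule prob_space.prob_space_distr)
  have "AE x in distr M (count_space UNIV) T. measure (distr M (count_space UNIV) T) {x} \<noteq> 0"
    by (subst D.AE_support_countable) (auto intro: exI[of _ UNIV])
  then have "measure_pmf (Abs_pmf (distr M (count_space UNIV) T)) = distr M (count_space UNIV) T"
    by (intro Abs_pmf_inverse) (auto intro: D.prob_space_axioms)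
  with that show ?thesis by blast
qed

text \<open>Gluing: inside each cell of the partition into level sets of \<open>(T, U)\<close> the product law is used.\<close>

lemma glued_coupling:
  fixes T :: "'a \<Rightarrow> 'i::countable" and U :: "'b \<Rightarrow> 'j::countable"
  assumes "prob_space M" "prob_space N"
    and T [measurable]: "T \<in> measurable M (count_space UNIV)"
    and U [measurable]: "U \<in> measurable N (count_space UNIV)"
    and p: "measure_pmf (map_pmf fst \<rho>) = distr M (count_space UNIV) T"
    and q: "measure_pmf (map_pmf snd \<rho>) = distr N (count_space UNIV) U"
  obtains \<pi> where "sets \<pi> = sets (M \<Otimes>\<^sub>M N)" "distr \<pi> M fst = M" "distr \<pi> N snd = N"
    "\<And>g. (\<integral>\<^sup>+z. g (T (fst z), U (snd z)) \<partial>\<pi>) = (\<integral>\<^sup>+z. g z \<partial>measure_pmf \<rho>)"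
proof -
  interpret M: prob_space M by fact
  interpret N: prob_space N by fact
  interpret pair_sigma_finite M N ..
  define w where "w z = relative_density \<rho> (T (fst z)) (U (snd z))" for z
  define \<pi> where "\<pi> = density (M \<Otimes>\<^sub>M N) w"
  \<comment> \<open>The product of two countable discrete spaces is discrete, so every function of
    the pair of cells is measurable.\<close>
  have meas_TU: "(\<lambda>z. g (T (fst z)) (U (snd z))) \<in> borel_measurable (M \<Otimes>\<^sub>M N)"
    for g :: "'i \<Rightarrow> 'j \<Rightarrow> ennreal"
  proof -
    have "(\<lambda>z. (T (fst z), U (snd z))) \<in> measurable (M \<Otimes>\<^sub>M N) (count_space UNIV \<Otimes>\<^sub>M count_space UNIV)"
      by measurable
    also have "count_space UNIV \<Otimes>\<^sub>M count_space UNIV = (count_space UNIV :: ('i \<times> 'j) measure)"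
      by (simp add: pair_measure_countable)
    finally have "(\<lambda>z. (\<lambda>(i, j). g i j) (T (fst z), U (snd z))) \<in> borel_measurable (M \<Otimes>\<^sub>M N)"
      by (rule measurable_compose) simp
    then show ?thesis by simp
  qed
  have w [measurable]: "w \<in> borel_measurable (M \<Otimes>\<^sub>M N)"
    unfolding w_def by (rule meas_TU)
  have int_T: "(\<integral>\<^sup>+x. g (T x) \<partial>M) = (\<integral>\<^sup>+i. g i \<partial>measure_pmf (map_pmf fst \<rho>))" for g :: "'i \<Rightarrow> ennreal"
    unfolding p by (rule nn_integral_distr[symmetric]) auto
  have int_U: "(\<integral>\<^sup>+y. g (U y) \<partial>N) = (\<integral>\<^sup>+j. g j \<partial>measure_pmf (map_pmf snd \<rho>))" for g :: "'j \<Rightarrow> ennreal"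
    unfolding q by (rule nn_integral_distr[symmetric]) auto
  \<comment> \<open>In cells of mass zero the relative density does not integrate to 1; almost no
    point lies in one.\<close>
  have pos_T: "AE x in M. pmf (map_pmf fst \<rho>) (T x) \<noteq> 0"
  proof (rule AE_distrD[OF T])
    show "AE i in distr M (count_space UNIV) T. pmf (map_pmf fst \<rho>) i \<noteq> 0"
      unfolding p[symmetric] AE_measure_pmf_iff pmf_eq_0_set_pmf by blast
  qed
  have pos_U: "AE y in N. pmf (map_pmf snd \<rho>) (U y) \<noteq> 0"
  proof (rule AE_distrD[OF U])
    show "AE j in distr N (count_space UNIV) U. pmf (map_pmf snd \<rho>) j \<noteq> 0"
      unfolding q[symmetric] AE_measure_pmf_iff pmf_eq_0_set_pmf by blast
  qed
  have sets: "sets \<pi> = sets (M \<Otimes>\<^sub>M N)"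
    by (simp add: \<pi>_def)
  have "distr \<pi> M fst = M"
  proof (rule measure_eqI)
    fix A assume "A \<in> sets (distr \<pi> M fst)"
    then have A [measurable]: "A \<in> sets M" by simp
    have "emeasure (distr \<pi> M fst) A = (\<integral>\<^sup>+z. indicator A (fst z) \<partial>\<pi>)"
      using A sets by (subst nn_integral_indicator[symmetric])
        (auto simp: nn_integral_distr \<pi>_def simp del: nn_integral_indicator)
    also have "\<dots> = (\<integral>\<^sup>+z. w z * indicator A (fst z) \<partial>(M \<Otimes>\<^sub>M N))"
      unfolding \<pi>_def by (intro nn_integral_density) measurable
    also have "\<dots> = (\<integral>\<^sup>+x. \<integral>\<^sup>+y. w (x, y) * indicator A x \<partial>N \<partial>M)"
      by (subst N.nn_integral_fst[symmetric]) auto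
    also have "\<dots> = (\<integral>\<^sup>+x. (\<integral>\<^sup>+y. w (x, y) \<partial>N) * indicator A x \<partial>M)"
      by (intro nn_integral_cong nn_integral_multc) measurable
    also have "\<dots> = (\<integral>\<^sup>+x. indicator A x \<partial>M)"
    proof (rule nn_integral_cong_AE)
      show "AE x in M. (\<integral>\<^sup>+y. w (x, y) \<partial>N) * indicator A x = indicator A x"
        using pos_T
        by eventually_elim
          (simp only: w_def fst_conv snd_conv int_U relative_density_fst simp_thms mult_1)
    qed
    finally show "emeasure (distr \<pi> M fst) A = emeasure M A" by simp
  qed simp
  moreover have "distr \<pi> N snd = N"
  proof (rule measure_eqI)
    fix A assume "A \<in> sets (distr \<pi> N snd)"
    then have A [measurable]: "A \<in> sets N" by simp
    have "emeasure (distr \<pi> N snd) A = (\<integral>\<^sup>+z. indicator A (snd z) \<partial>\<pi>)"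
      using A sets by (subst nn_integral_indicator[symmetric])
        (auto simp: nn_integral_distr \<pi>_def simp del: nn_integral_indicator)
    also have "\<dots> = (\<integral>\<^sup>+z. w z * indicator A (snd z) \<partial>(M \<Otimes>\<^sub>M N))"
      unfolding \<pi>_def by (intro nn_integral_density) measurable
    also have "\<dots> = (\<integral>\<^sup>+y. \<integral>\<^sup>+x. w (x, y) * indicator A y \<partial>M \<partial>N)"
      by (subst nn_integral_snd[symmetric]) auto
    also have "\<dots> = (\<integral>\<^sup>+y. (\<integral>\<^sup>+x. w (x, y) \<partial>M) * indicator A y \<partial>N)"
      by (intro nn_integral_cong nn_integral_multc) measurable
    also have "\<dots> = (\<integral>\<^sup>+y. indicator A y \<partial>N)"
    proof (rule nn_integral_cong_AE)
      show "AE y in N. (\<integral>\<^sup>+x. w (x, y) \<partial>M) * indicator A y = indicator A y"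
        using pos_U
        by eventually_elim
          (simp only: w_def fst_conv snd_conv int_T[of "\<lambda>i. relative_density \<rho> i (U _)"]
            relative_density_snd simp_thms mult_1)
    qed
    finally show "emeasure (distr \<pi> N snd) A = emeasure N A" by simp
  qed simp
  moreover have "(\<integral>\<^sup>+z. g (T (fst z), U (snd z)) \<partial>\<pi>) = (\<integral>\<^sup>+z. g z \<partial>measure_pmf \<rho>)" for g
  proof -
    have [measurable]: "(\<lambda>z. g (T (fst z), U (snd z))) \<in> borel_measurable (M \<Otimes>\<^sub>M N)"
      by (rule meas_TU)
    have "(\<integral>\<^sup>+z. g (T (fst z), U (snd z)) \<partial>\<pi>) =
        (\<integral>\<^sup>+z. w z * g (T (fst z), U (snd z)) \<partial>(M \<Otimes>\<^sub>M N))"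
      unfolding \<pi>_def by (intro nn_integral_density) measurable
    also have "\<dots> = (\<integral>\<^sup>+x. \<integral>\<^sup>+y. w (x, y) * g (T x, U y) \<partial>N \<partial>M)"
      by (subst N.nn_integral_fst[symmetric]) auto
    also have "\<dots> = (\<integral>\<^sup>+x. \<integral>\<^sup>+j. relative_density \<rho> (T x) j * g (T x, j) \<partial>measure_pmf (map_pmf snd \<rho>) \<partial>M)"
      by (simp add: w_def int_U[of "\<lambda>j. relative_density \<rho> (T _) j * g (T _, j)"])
    also have "\<dots> = (\<integral>\<^sup>+z. g z \<partial>measure_pmf \<rho>)"
      by (subst int_T) (rule nn_integral_relative_density)
    finally show ?thesis .
  qed
  ultimately show ?thesis
    using sets that by blast
qed

section \<open>Lipschitz test functions and the two halves of duality\<close>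

lemma lipschitz1_measurable:
  fixes f :: "'a::metric_space \<Rightarrow> real"
  assumes "\<And>x y. f x - f y \<le> dist x y"
  shows "f \<in> borel_measurable borel"
proof (rule borel_measurable_continuous_onI)
  have "1-lipschitz_on UNIV f"
  proof (rule lipschitz_onI)
    show "dist (f x) (f y) \<le> 1 * dist x y" for x y
      using assms[of x y] assms[of y x] by (simp add: dist_real_def dist_commute)
  qed simp
  then show "continuous_on UNIV f"
    by (rule lipschitz_on_continuous_on)
qed

lemma ennreal_integral_le_nn_integral:
  assumes f: "integrable M f"
  shows "ennreal (\<integral>x. f x \<partial>M) \<le> (\<integral>\<^sup>+x. ennreal (f x) \<partial>M)"
proof -
  have "ennreal (\<integral>x. f x \<partial>M) \<le> ennreal (\<integral>x. max 0 (f x) \<partial>M)"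
    using f by (intro ennreal_leI integral_mono) auto
  also have "\<dots> = (\<integral>\<^sup>+x. ennreal (max 0 (f x)) \<partial>M)"
    using f by (intro nn_integral_eq_integral[symmetric]) auto
  also have "\<dots> = (\<integral>\<^sup>+x. ennreal (f x) \<partial>M)"
    by (intro nn_integral_cong) (auto simp: max_def ennreal_neg)
  finally show ?thesis .
qed

text \<open>The easy half of duality: under any coupling the difference of integrals is the mean of
  \<open>f (fst z) - f (snd z)\<close>, which is at most the distance.\<close>

lemma lipschitz1_le_W1:
  fixes \<mu> \<nu> :: "'a::polish_space measure"
  assumes bounded: "\<And>x. \<bar>f x\<bar> \<le> B" and lip: "\<And>x y. f x - f y \<le> dist x y"
  shows "ennreal ((\<integral>x. f x \<partial>\<mu>) - (\<integral>x. f x \<partial>\<nu>)) \<le> W1 \<mu> \<nu>"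
  unfolding W1_def
proof (rule INF_greatest)
  fix \<pi> :: "('a \<times> 'a) measure"
  assume "\<pi> \<in> {\<pi>. sets \<pi> = sets (borel \<Otimes>\<^sub>M borel) \<and> coupling \<pi> fst snd \<mu> \<nu>}"
  then have "prob_space \<pi>" and [measurable]: "fst \<in> borel_measurable \<pi>" "snd \<in> borel_measurable \<pi>"
    and \<mu>: "\<mu> = distr \<pi> borel fst" and \<nu>: "\<nu> = distr \<pi> borel snd"
    by (auto simp: coupling_def)
  interpret prob_space \<pi> by fact
  have f [measurable]: "f \<in> borel_measurable borel"
    using lip by (rule lipschitz1_measurable)
  have int: "integrable \<pi> (\<lambda>z. f (g z))" if "g \<in> borel_measurable \<pi>" for g
    using that bounded by (intro integrable_const_bound[where B=B]) auto
  have "(\<integral>x. f x \<partial>\<mu>) - (\<integral>x. f x \<partial>\<nu>) = (\<integral>z. f (fst z) - f (snd z) \<partial>\<pi>)"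
    by (simp add: \<mu> \<nu> integral_distr int)
  also have "ennreal \<dots> \<le> (\<integral>\<^sup>+z. ennreal (f (fst z) - f (snd z)) \<partial>\<pi>)"
    by (intro ennreal_integral_le_nn_integral Bochner_Integration.integrable_diff int) auto
  also have "\<dots> \<le> (\<integral>\<^sup>+z. ennreal (dist (fst z) (snd z)) \<partial>\<pi>)"
    by (intro nn_integral_mono ennreal_leI lip)
  finally show "ennreal ((\<integral>x. f x \<partial>\<mu>) - (\<integral>x. f x \<partial>\<nu>)) \<le> (\<integral>\<^sup>+z. ennreal (dist (fst z) (snd z)) \<partial>\<pi>)" .
qed

lemma dense_sequence_exists:
  obtains a :: "nat \<Rightarrow> 'a::{metric_space, second_countable_topology}"
  where "\<And>x e. e > 0 \<Longrightarrow> \<exists>n. dist x (a n) < e"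
proof -
  obtain D :: "'a set" where D: "countable D" "\<And>X. open X \<Longrightarrow> X \<noteq> {} \<Longrightarrow> \<exists>d\<in>D. d \<in> X"
    using countable_dense_setE by blast
  have "D \<noteq> {}"
    using D(2)[of UNIV] by auto
  show ?thesis
  proof (rule that[of "from_nat_into D"])
    fix x :: 'a and e :: real assume "e > 0"
    then obtain d where "d \<in> D" "d \<in> ball x e"
      using D(2)[of "ball x e"] by auto
    with D(1) show "\<exists>n. dist x (from_nat_into D n) < e"
      using from_nat_into_surj[of D d] by auto
  qed
qed

text \<open>
  Both measures are pushed forward to a countable \<open>\<epsilon>\<close>-dense set. A McShane extension turns
  potentials there into Lipschitz functions, and the discrete optimal coupling is glued back.
\<close>

theorem kantorovich_rubinstein:
  fixes \<mu> \<nu> :: "'a::polish_space measure"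
  assumes "prob_space \<mu>" "prob_space \<nu>" and sets: "sets \<mu> = sets borel" "sets \<nu> = sets borel"
    and dual: "\<And>f B. (\<And>x. \<bar>f x\<bar> \<le> B) \<Longrightarrow> (\<And>x y. f x - f y \<le> dist x y) \<Longrightarrow>
      (\<integral>x. f x \<partial>\<mu>) - (\<integral>x. f x \<partial>\<nu>) \<le> S"
  shows "W1 \<mu> \<nu> \<le> ennreal S"
proof (rule ennreal_le_epsilon)
  fix e :: real assume "e > 0"
  \<comment> \<open>Discretisation costs \<epsilon> for each marginal in the dual bound, and again
    \<epsilon> for each of the two points in the distance.\<close>
  define \<epsilon> where "\<epsilon> = e / 4"
  have \<epsilon>: "\<epsilon> > 0" using \<open>e > 0\<close> by (simp add: \<epsilon>_def)
  have S: "S \<ge> 0"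
    using dual[of "\<lambda>_. 0" 0] by simp
  interpret \<mu>: prob_space \<mu> by fact
  interpret \<nu>: prob_space \<nu> by fact
  note sets[measurable_cong]
  obtain a :: "nat \<Rightarrow> 'a" where a: "\<And>x e. e > 0 \<Longrightarrow> \<exists>n. dist x (a n) < e"
    by (rule dense_sequence_exists) blast
  \<comment> \<open>The least index makes the cells disjoint and \<open>T\<close>
    measurable.\<close>
  define T where "T x = (LEAST n. dist x (a n) < \<epsilon>)" for x
  have T_near: "dist x (a (T x)) < \<epsilon>" for x
    unfolding T_def using a[OF \<epsilon>] by (rule LeastI_ex)
  have [measurable]: "T \<in> measurable borel (count_space UNIV)"
    unfolding T_def by measurable
  have T: "T \<in> measurable \<mu> (count_space UNIV)" "T \<in> measurable \<nu> (count_space UNIV)"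
    by measurable
  obtain p where p: "measure_pmf p = distr \<mu> (count_space UNIV) T"
    using pmf_of_countable_distr[OF \<open>prob_space \<mu>\<close> T(1)] by blast
  obtain q where q: "measure_pmf q = distr \<nu> (count_space UNIV) T"
    using pmf_of_countable_distr[OF \<open>prob_space \<nu>\<close> T(2)] by blast
  have pseudo: "pseudometric (\<lambda>i j. dist (a i) (a j))"
    by unfold_locales (simp_all add: dist_commute dist_triangle2)
  have dual_pmf: "measure_pmf.expectation p f - measure_pmf.expectation q f \<le> S + 2 * \<epsilon>"
    if f_bd: "\<And>i. \<bar>f i\<bar> \<le> B" and f_lip: "\<And>i j. f i - f j \<le> dist (a i) (a j)" for f B
  proof -
    \<comment> \<open>\<open>G\<close> is the McShane extension, an infimum of cones over the net,
      bounded below by \<open>- B\<close>. The cap at \<open>B\<close> in \<open>F\<close> restores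
      the upper bound and keeps the Lipschitz constant.\<close>
    define G where "G x = (INF i. f i + dist x (a i))" for x
    define F where "F x = min B (G x)" for x
    have bdd: "bdd_below (range (\<lambda>i. f i + dist x (a i)))" for x
    proof (rule bdd_belowI2)
      show "- B \<le> f i + dist x (a i)" for i
        using f_bd[of i] zero_le_dist[of x "a i"] by linarith
    qed
    have G_le: "G x \<le> f i + dist x (a i)" for x i
      unfolding G_def using bdd by (rule cINF_lower) simp
    have G_ge: "f i - dist x (a i) \<le> G x" for x i
      unfolding G_def
    proof (rule cINF_greatest)
      show "f i - dist x (a i) \<le> f j + dist x (a j)" for j
        using f_lip[of i j] dist_triangle[of "a i" "a j" x] by (simp add: dist_commute)
    qed simp
    have G_low: "- B \<le> G x" for x
      unfolding G_def
    proof (rule cINF_greatest)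
      show "- B \<le> f i + dist x (a i)" for i
        using f_bd[of i] zero_le_dist[of x "a i"] by linarith
    qed simp
    have F_bd: "\<bar>F x\<bar> \<le> B" for x
      using f_bd[of 0] G_low[of x] by (auto simp: F_def min_def abs_le_iff)
    have G_lip: "G x - dist x y \<le> G y" for x y
      unfolding G_def[of y]
    proof (rule cINF_greatest)
      show "G x - dist x y \<le> f i + dist y (a i)" for i
        using G_le[of x i] dist_triangle[of x "a i" y] by linarith
    qed simp
    have F_lip: "F x - F y \<le> dist x y" for x y
      using G_lip[of x y] zero_le_dist[of x y] unfolding F_def by linarith
    \<comment> \<open>Evaluating the cone over the representative of the cell of \<open>x\<close>
      bounds \<open>G x\<close> from above, and the Lipschitz bound on \<open>f\<close> bounds it
      from below.\<close>
    have F_near: "\<bar>f (T x) - F x\<bar> \<le> \<epsilon>" for x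
      using G_le[of x "T x"] G_ge[of "T x" x] T_near[of x] f_bd[of "T x"]
      by (auto simp: F_def min_def abs_le_iff)
    have [measurable]: "F \<in> borel_measurable borel"
      using F_lip by (rule lipschitz1_measurable)
    have int_f: "integrable \<mu> (\<lambda>x. f (T x))" "integrable \<nu> (\<lambda>x. f (T x))"
      using f_bd by (auto intro!: \<mu>.integrable_const_bound[where B=B] \<nu>.integrable_const_bound[where B=B])
    have int_F: "integrable \<mu> F" "integrable \<nu> F"
      using F_bd by (auto intro!: \<mu>.integrable_const_bound[where B=B] \<nu>.integrable_const_bound[where B=B])
    have "measure_pmf.expectation p f = (\<integral>x. f (T x) \<partial>\<mu>)"
      unfolding p by (rule integral_distr) auto
    also have "\<dots> \<le> (\<integral>x. F x + \<epsilon> \<partial>\<mu>)"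
      using F_near int_f int_F by (intro integral_mono) (auto simp: abs_le_iff algebra_simps)
    also have "\<dots> = (\<integral>x. F x \<partial>\<mu>) + \<epsilon>"
      using int_F by (simp add: \<mu>.prob_space)
    finally have 1: "measure_pmf.expectation p f \<le> (\<integral>x. F x \<partial>\<mu>) + \<epsilon>" .
    have "(\<integral>x. F x \<partial>\<nu>) - \<epsilon> = (\<integral>x. F x - \<epsilon> \<partial>\<nu>)"
      using int_F by (simp add: \<nu>.prob_space)
    also have "\<dots> \<le> (\<integral>x. f (T x) \<partial>\<nu>)"
    proof (intro integral_mono)
      show "F x - \<epsilon> \<le> f (T x)" for x
        using F_near[of x] by linarith
    qed (use int_f int_F in auto)
    also have "\<dots> = measure_pmf.expectation q f"
      unfolding q by (rule integral_distr[symmetric]) auto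
    finally have "(\<integral>x. F x \<partial>\<nu>) - \<epsilon> \<le> measure_pmf.expectation q f" .
    with 1 dual[OF F_bd F_lip] show ?thesis by linarith
  qed
  obtain \<rho> where \<rho>: "\<rho> \<in> pmf_couplings p q"
    and cost: "(\<integral>\<^sup>+z. ennreal (dist (a (fst z)) (a (snd z))) \<partial>measure_pmf \<rho>) \<le> ennreal (S + 2 * \<epsilon>)"
  proof (rule duality_pmf[OF pseudo])
    show "measure_pmf.expectation p f - measure_pmf.expectation q f \<le> S + 2 * \<epsilon>"
      if "\<And>i. \<bar>f i\<bar> \<le> B" "\<And>i j. f i - f j \<le> dist (a i) (a j)" for f B
      using that by (rule dual_pmf)
  qed blast
  obtain \<pi> where \<pi>: "sets \<pi> = sets (\<mu> \<Otimes>\<^sub>M \<nu>)" "distr \<pi> \<mu> fst = \<mu>" "distr \<pi> \<nu> snd = \<nu>"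
    and int: "\<And>g. (\<integral>\<^sup>+z. g (T (fst z), T (snd z)) \<partial>\<pi>) = (\<integral>\<^sup>+z. g z \<partial>measure_pmf \<rho>)"
    using glued_coupling[OF \<open>prob_space \<mu>\<close> \<open>prob_space \<nu>\<close> T, of \<rho>] \<rho> p q
    unfolding pmf_couplings_def by blast
  have sets_\<pi>: "sets \<pi> = sets (borel \<Otimes>\<^sub>M borel)"
    using \<pi>(1) sets by (simp cong: sets_pair_measure_cong)
  have meas: "fst \<in> borel_measurable \<pi>" "snd \<in> borel_measurable \<pi>"
    using sets_\<pi> by (simp_all cong: measurable_cong_sets)
  have "emeasure \<pi> (space \<pi>) = (\<integral>\<^sup>+z. 1 \<partial>\<pi>)"
    by simp
  also have "\<dots> = 1"
    using int[of "\<lambda>_. 1"] by simp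
  finally have "prob_space \<pi>"
    by (rule prob_spaceI)
  moreover have "distr \<pi> borel fst = \<mu>" "distr \<pi> borel snd = \<nu>"
    using \<pi>(2,3) sets by (metis distr_cong)+
  ultimately have "coupling \<pi> fst snd \<mu> \<nu>"
    using meas by (simp add: coupling_def)
  then have "W1 \<mu> \<nu> \<le> (\<integral>\<^sup>+z. ennreal (dist (fst z) (snd z)) \<partial>\<pi>)"
    unfolding W1_def using sets_\<pi> by (intro INF_lower) simp
  \<comment> \<open>The majorant depends only on the pair of cells, so its integral is computed
    under the discrete \<rho>.\<close>
  also have "\<dots> \<le> (\<integral>\<^sup>+z. (\<lambda>z. ennreal (dist (a (fst z)) (a (snd z))) + ennreal (2 * \<epsilon>)) (T (fst z), T (snd z)) \<partial>\<pi>)"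
  proof (rule nn_integral_mono)
    fix z :: "'a \<times> 'a"
    have "dist (fst z) (snd z) \<le> dist (a (T (fst z))) (a (T (snd z))) + 2 * \<epsilon>"
      using T_near[of "fst z"] T_near[of "snd z"] dist_triangle[of "fst z" "snd z" "a (T (fst z))"]
        dist_triangle[of "a (T (fst z))" "snd z" "a (T (snd z))"]
      by (simp add: dist_commute)
    then show "ennreal (dist (fst z) (snd z)) \<le>
      (\<lambda>z. ennreal (dist (a (fst z)) (a (snd z))) + ennreal (2 * \<epsilon>)) (T (fst z), T (snd z))"
      using \<epsilon> by (simp add: ennreal_leI flip: ennreal_plus)
  qed
  also have "\<dots> = (\<integral>\<^sup>+z. ennreal (dist (a (fst z)) (a (snd z))) + ennreal (2 * \<epsilon>) \<partial>measure_pmf \<rho>)"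
    by (rule int)
  also have "\<dots> = (\<integral>\<^sup>+z. ennreal (dist (a (fst z)) (a (snd z))) \<partial>measure_pmf \<rho>) + ennreal (2 * \<epsilon>)"
    by (simp add: nn_integral_add)
  also have "\<dots> \<le> ennreal (S + 2 * \<epsilon>) + ennreal (2 * \<epsilon>)"
    using cost by (rule add_right_mono)
  also have "\<dots> = ennreal S + ennreal e"
    using S \<epsilon> \<open>e > 0\<close> by (simp add: \<epsilon>_def flip: ennreal_plus)
  finally show "W1 \<mu> \<nu> \<le> ennreal S + ennreal e" .
qed

subsection \<open>Curvature\<close>

lemma step_kernel_measurable:
  assumes P: "P \<in> measurable borel (prob_algebra borel)"
  shows "step_kernel P k \<in> measurable borel (prob_algebra borel)"
proof (induction k)
  case 0
  have "return borel \<in> measurable borel (prob_algebra (borel :: 'a measure))"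
    by (rule measurable_return_prob_space)
  moreover have "step_kernel P 0 = return borel"
    by (simp add: fun_eq_iff)
  ultimately show ?case by simp
next
  case (Suc k)
  have "step_kernel P (Suc k) = (\<lambda>x. bind (P x) (step_kernel P k))"
    by (simp add: fun_eq_iff)
  with measurable_bind_prob_space[OF P Suc] show ?case by simp
qed

lemma step_kernel_1:
  assumes P: "P \<in> measurable borel (prob_algebra borel)"
  shows "step_kernel P 1 x = P x"
proof -
  have "sets (P x) = sets borel"
    using measurable_space[OF P, of x] by (simp add: space_prob_algebra)
  moreover have "step_kernel P 0 = return borel"
    by (simp add: fun_eq_iff)
  ultimately show ?thesis
    by (simp add: bind_return'')
qed

text \<open>A coupling with a Dirac mass has first component almost surely \<open>z\<close>, so its
  cost is the first moment of \<mu> about \<open>z\<close>.\<close>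

lemma nn_integral_dist_finite:
  fixes \<mu> :: "'a::polish_space measure"
  assumes "W1 (return borel z) \<mu> < \<infinity>"
  shows "(\<integral>\<^sup>+x. ennreal (dist z x) \<partial>\<mu>) < \<infinity>"
proof -
  obtain \<pi> :: "('a \<times> 'a) measure" where "coupling \<pi> fst snd (return borel z) \<mu>"
    and fin: "(\<integral>\<^sup>+p. ennreal (dist (fst p) (snd p)) \<partial>\<pi>) < \<infinity>"
    using assms unfolding W1_def INF_less_iff by auto
  then have [measurable]: "fst \<in> borel_measurable \<pi>" "snd \<in> borel_measurable \<pi>"
    and z: "distr \<pi> borel fst = return borel z" and \<mu>: "\<mu> = distr \<pi> borel snd"
    by (auto simp: coupling_def)
  have "AE p in \<pi>. fst p = z"
  proof (rule AE_distrD[where M'=borel and f=fst])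
    show "AE p in distr \<pi> borel fst. p = z"
      unfolding z by (subst AE_return) (simp_all add: pred_def)
  qed simp
  then have "(\<integral>\<^sup>+p. ennreal (dist z (snd p)) \<partial>\<pi>) = (\<integral>\<^sup>+p. ennreal (dist (fst p) (snd p)) \<partial>\<pi>)"
    by (intro nn_integral_cong_AE) auto
  with fin show ?thesis
    by (simp add: \<mu> nn_integral_distr)
qed

text \<open>The triangle inequality through \<open>x\<close> and \<open>y\<close> leaves two first
  moments and the constant \<open>dist x y\<close>.\<close>

lemma coupling_dist_integrable:
  fixes X Y :: "'b \<Rightarrow> 'a::polish_space"
  assumes coupl: "coupling M X Y \<mu> \<nu>"
    and fin: "W1 (return borel x) \<mu> < \<infinity>" "W1 (return borel y) \<nu> < \<infinity>"
  shows "integrable M (\<lambda>w. dist (X w) (Y w))"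
proof (rule integrableI_nonneg)
  have [measurable]: "X \<in> borel_measurable M" "Y \<in> borel_measurable M"
    and \<mu>: "\<mu> = distr M borel X" and \<nu>: "\<nu> = distr M borel Y"
    and "prob_space M"
    using coupl by (auto simp: coupling_def)
  interpret prob_space M by fact
  show "(\<lambda>w. dist (X w) (Y w)) \<in> borel_measurable M"
    by measurable
  have X: "(\<integral>\<^sup>+w. ennreal (dist x (X w)) \<partial>M) < \<infinity>"
    using nn_integral_dist_finite[OF fin(1)] by (simp add: \<mu> nn_integral_distr)
  have Y: "(\<integral>\<^sup>+w. ennreal (dist y (Y w)) \<partial>M) < \<infinity>"
    using nn_integral_dist_finite[OF fin(2)] by (simp add: \<nu> nn_integral_distr)
  have "(\<integral>\<^sup>+w. ennreal (dist (X w) (Y w)) \<partial>M) \<le>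
      (\<integral>\<^sup>+w. ennreal (dist x (X w)) + (ennreal (dist y (Y w)) + ennreal (dist x y)) \<partial>M)"
  proof (rule nn_integral_mono)
    fix w
    have "dist (X w) (Y w) \<le> dist x (X w) + (dist y (Y w) + dist x y)"
      using dist_triangle[of "X w" "Y w" x] dist_triangle[of x "Y w" y]
      by (simp add: dist_commute)
    then show "ennreal (dist (X w) (Y w)) \<le>
        ennreal (dist x (X w)) + (ennreal (dist y (Y w)) + ennreal (dist x y))"
      by (simp add: ennreal_leI flip: ennreal_plus)
  qed
  also have "\<dots> = (\<integral>\<^sup>+w. ennreal (dist x (X w)) \<partial>M) +
      ((\<integral>\<^sup>+w. ennreal (dist y (Y w)) \<partial>M) + ennreal (dist x y))"
    by (simp add: nn_integral_add emeasure_space_1)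
  also have "\<dots> < \<infinity>"
    using X Y by (simp add: ennreal_add_less_top)
  finally show "(\<integral>\<^sup>+w. ennreal (dist (X w) (Y w)) \<partial>M) < \<infinity>" .
qed simp

text \<open>Conditioning on the first step: with \<open>g z\<close> the integral of \<open>f\<close>
  under \<open>K z\<close>, \<open>u\<close> is \<open>g (X w) - g (Y w)\<close>. Measurability of
  the kernel makes \<open>g\<close> measurable, and the pointwise bound is the easy half of
  duality.\<close>

lemma expectation_coupling_kernel:
  fixes f :: "'a::polish_space \<Rightarrow> real" and K :: "'a \<Rightarrow> 'a measure"
  assumes coupl: "coupling M X Y \<mu> \<nu>"
    and K: "K \<in> measurable borel (prob_algebra borel)"
    and bounded: "\<And>x. \<bar>f x\<bar> \<le> B" and lip: "\<And>x y. f x - f y \<le> dist x y"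
  defines "u \<equiv> \<lambda>w. (\<integral>z. f z \<partial>K (X w)) - (\<integral>z. f z \<partial>K (Y w))"
  shows "integrable M u"
    and "(\<integral>z. f z \<partial>(\<mu> \<bind> K)) - (\<integral>z. f z \<partial>(\<nu> \<bind> K)) = (\<integral>w. u w \<partial>M)"
    and "ennreal (u w) \<le> W1 (K (X w)) (K (Y w))"
proof -
  have X [measurable]: "X \<in> borel_measurable M" and Y [measurable]: "Y \<in> borel_measurable M"
    and \<mu>: "\<mu> = distr M borel X" and \<nu>: "\<nu> = distr M borel Y"
    and "prob_space M"
    using coupl by (auto simp: coupling_def)
  interpret prob_space M by fact
  have K' [measurable]: "K \<in> measurable borel (subprob_algebra borel)"
    using K by (rule measurable_prob_algebraD)
  have K_prob: "prob_space (K z)" and K_sets: "sets (K z) = sets borel" for z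
    using measurable_space[OF K, of z] by (auto simp: space_prob_algebra)
  have f [measurable]: "f \<in> borel_measurable borel"
    using lip by (rule lipschitz1_measurable)
  define g where "g z = (\<integral>x. f x \<partial>K z)" for z
  have g [measurable]: "g \<in> borel_measurable borel"
    unfolding g_def by measurable
  have g_bd: "\<bar>g z\<bar> \<le> B" for z
  proof -
    interpret K: prob_space "K z" by (rule K_prob)
    have "B \<ge> 0"
      using bounded[of undefined] by linarith
    have "\<bar>g z\<bar> \<le> (\<integral>x. \<bar>f x\<bar> \<partial>K z)"
      unfolding g_def by (rule integral_abs_bound)
    also have "\<dots> \<le> (\<integral>x. B \<partial>K z)"
      using bounded K_sets[of z] \<open>B \<ge> 0\<close>
      by (intro integral_mono K.integrable_const_bound[where B=B]) (auto cong: measurable_cong_sets)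
    finally show ?thesis by (simp add: K.prob_space)
  qed
  have int: "integrable M (\<lambda>w. g (Z w))" if [measurable]: "Z \<in> borel_measurable M" for Z
    using g_bd by (intro integrable_const_bound[where B=B]) auto
  have bind: "(\<integral>z. f z \<partial>(distr M borel Z \<bind> K)) = (\<integral>w. g (Z w) \<partial>M)"
    if [measurable]: "Z \<in> borel_measurable M" for Z
  proof -
    interpret D: prob_space "distr M borel Z" by (rule prob_space_distr) fact
    have "(\<integral>z. f z \<partial>(distr M borel Z \<bind> K)) = (\<integral>z. g z \<partial>distr M borel Z)"
      unfolding g_def
      by (rule integral_bind[where K=borel and B=B and B'=1])
        (auto simp: bounded K_prob prob_space.emeasure_space_1 D.finite_measure_axioms)
    then show ?thesis by (simp add: integral_distr)
  qed
  show "integrable M u"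
    unfolding u_def g_def[symmetric] using int[OF X] int[OF Y] by simp
  show "(\<integral>z. f z \<partial>(\<mu> \<bind> K)) - (\<integral>z. f z \<partial>(\<nu> \<bind> K)) = (\<integral>w. u w \<partial>M)"
    unfolding u_def g_def[symmetric] \<mu> \<nu> using int[OF X] int[OF Y] by (simp add: bind)
  show "ennreal (u w) \<le> W1 (K (X w)) (K (Y w))"
    unfolding u_def using bounded lip by (rule lipschitz1_le_W1)
qed

text \<open>Here \<open>D\<close> stands for the distance of \<open>X\<close> and \<open>Y\<close>,
  \<open>d\<close> for that of \<open>x\<close> and \<open>y\<close>, and \<open>G\<close> for the
  Wasserstein distance of the two kernels. If \<open>G\<close> is finite,
  \<open>D * (1 - \<kappa>) = G\<close>; if not, \<kappa> is minus infinity and extended arithmetic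
  settles the bounds.\<close>

lemma curvature_cost_bounds:
  fixes D d u :: real and G :: ennreal
  assumes "D > 0" "d > 0" "ennreal u \<le> G"
  defines "\<kappa> \<equiv> 1 - enn2ereal G / ereal D"
  shows "ereal D * (1 - \<kappa>) / ereal d \<ge> ereal (u / d)"
    and "\<kappa> * ereal D / ereal d \<le> ereal ((D - u) / d)"
    and "ereal D * (1 - \<kappa>) / ereal d \<ge> 0"
proof -
  have "ereal D * (1 - \<kappa>) / ereal d \<ge> ereal (u / d) \<and> \<kappa> * ereal D / ereal d \<le> ereal ((D - u) / d) \<and>
    ereal D * (1 - \<kappa>) / ereal d \<ge> 0"
  proof (cases G)
    case (real r)
    then have "u \<le> r"
      using assms(3) by (cases "u \<ge> 0") auto
    moreover have "\<kappa> = ereal (1 - r / D)"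
      using real assms(1) by (simp add: \<kappa>_def one_ereal_def enn2ereal_ennreal)
    ultimately show ?thesis
      using real assms(1,2) by (simp add: one_ereal_def field_simps)
  next
    case top
    then have "\<kappa> = - \<infinity>"
      using assms(1) by (simp add: \<kappa>_def one_ereal_def)
    then show ?thesis
      using assms(1,2) by (simp add: one_ereal_def)
  qed
  then show "ereal D * (1 - \<kappa>) / ereal d \<ge> ereal (u / d)"
    "\<kappa> * ereal D / ereal d \<le> ereal ((D - u) / d)"
    "ereal D * (1 - \<kappa>) / ereal d \<ge> 0"
    by auto
qed

lemma ereal_expectation_nonneg:
  assumes "\<And>w. f w \<ge> 0"
  shows "ereal_expectation M f = enn2ereal (\<integral>\<^sup>+w. e2ennreal (f w) \<partial>M)"
proof -
  have "e2ennreal (- f w) = 0" for w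
    using assms[of w] by (intro e2ennreal_neg) simp
  then show ?thesis by (simp add: ereal_expectation_def zero_ennreal.rep_eq)
qed

text \<open>For non-measurable \<open>f\<close>, \<open>nn_integral\<close> is the lower integral, which is still monotone.\<close>

lemma ereal_expectation_le:
  assumes le: "\<And>w. f w \<le> ereal (g w)" and g: "integrable M g"
  shows "ereal_expectation M f \<le> ereal (\<integral>w. g w \<partial>M)"
proof -
  have fin: "(\<integral>\<^sup>+w. ennreal (g w) \<partial>M) < top" "(\<integral>\<^sup>+w. ennreal (- g w) \<partial>M) < top"
    using g unfolding real_integrable_def by (auto simp: less_top)
  have "e2ennreal (f w) \<le> ennreal (g w)" for w
    using e2ennreal_mono[OF le[of w]] by simp
  then have 1: "(\<integral>\<^sup>+w. e2ennreal (f w) \<partial>M) \<le> (\<integral>\<^sup>+w. ennreal (g w) \<partial>M)"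
    by (rule nn_integral_mono)
  have "- ereal (g w) \<le> - f w" for w
    using le[of w] by (simp only: ereal_minus_le_minus)
  from e2ennreal_mono[OF this] have "ennreal (- g w) \<le> e2ennreal (- f w)" for w
    by simp
  then have 2: "(\<integral>\<^sup>+w. ennreal (- g w) \<partial>M) \<le> (\<integral>\<^sup>+w. e2ennreal (- f w) \<partial>M)"
    by (rule nn_integral_mono)
  have "ereal_expectation M f \<le>
      enn2ereal (\<integral>\<^sup>+w. ennreal (g w) \<partial>M) - enn2ereal (\<integral>\<^sup>+w. ennreal (- g w) \<partial>M)"
    unfolding ereal_expectation_def using 1 2
    by (intro ereal_minus_mono) (simp_all add: less_eq_ennreal.rep_eq)
  also have "\<dots> = ereal (\<integral>w. g w \<partial>M)"
    using fin g by (auto simp: real_lebesgue_integral_def less_top_ennreal enn2ereal_ennreal)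
  finally show ?thesis .
qed

theorem proposition3p2:
  fixes P :: "'a::polish_space \<Rightarrow> 'a measure"
    and k :: nat
    and x y :: 'a
    and M :: "'b measure"
    and X Y :: "'b \<Rightarrow> 'a"
  assumes kernel: "P \<in> measurable borel (prob_algebra borel)"
    and finite_jump: "\<And>z. W1 (return borel z) (P z) < \<infinity>"
    and neq: "x \<noteq> y"
    and coupl: "coupling M X Y (P x) (P y)"
  shows
    "ricci_curv P (k + 1) x y \<ge>
       1 - ereal_expectation M
             (\<lambda>w. ereal (dist (X w) (Y w)) * (1 - ricci_curv P k (X w) (Y w)) / ereal (dist x y))
     \<and>
     (ereal_expectation M (\<lambda>w. ereal (dist (X w) (Y w))) = enn2ereal (W1 (P x) (P y)) \<longrightarrow>
        ricci_curv P (k + 1) x y \<ge>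
          ricci_curv P 1 x y +
          ereal_expectation M
            (\<lambda>w. ricci_curv P k (X w) (Y w) * ereal (dist (X w) (Y w)) / ereal (dist x y)))"
proof (intro conjI impI)
  define K where "K = step_kernel P k"
  define d where "d = dist x y"
  define D where "D w = dist (X w) (Y w)" for w
  define u where "u f w = (\<integral>z. f z \<partial>K (X w)) - (\<integral>z. f z \<partial>K (Y w))" for f :: "'a \<Rightarrow> real" and w
  have d: "d > 0"
    using neq by (simp add: d_def)
  have K: "K \<in> measurable borel (prob_algebra borel)"
    unfolding K_def using kernel by (rule step_kernel_measurable)
  have int_D: "integrable M D"
    unfolding D_def by (rule coupling_dist_integrable[OF coupl finite_jump finite_jump])
  have P_space: "P z \<in> space (prob_algebra borel)" for z
    using measurable_space[OF kernel, of z] by simp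
  have step: "step_kernel P (k + 1) z = P z \<bind> K" for z
    by (simp add: K_def)
  have curv: "ricci_curv P (k + 1) x y = 1 - enn2ereal (W1 (P x \<bind> K) (P y \<bind> K)) / ereal d"
    using neq by (simp add: ricci_curv_def K_def d_def)
  \<comment> \<open>Duality reduces both inequalities to bounds on the mean of \<open>u f\<close>
    that are uniform in \<open>f\<close>.\<close>
  have W1_le: "W1 (P x \<bind> K) (P y \<bind> K) \<le> ennreal S"
    if S: "\<And>f B. (\<And>z. \<bar>f z\<bar> \<le> B) \<Longrightarrow> (\<And>a b. f a - f b \<le> dist a b) \<Longrightarrow> (\<integral>w. u f w \<partial>M) \<le> S" for S
  proof (rule kantorovich_rubinstein)
    show "prob_space (P x \<bind> K)" "prob_space (P y \<bind> K)"
      "sets (P x \<bind> K) = sets borel" "sets (P y \<bind> K) = sets borel"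
      using prob_space_bind'[OF P_space K] sets_bind'[OF P_space K] by blast+
    show "(\<integral>z. f z \<partial>(P x \<bind> K)) - (\<integral>z. f z \<partial>(P y \<bind> K)) \<le> S"
      if "\<And>z. \<bar>f z\<bar> \<le> B" "\<And>a b. f a - f b \<le> dist a b" for f B
      using S[OF that] expectation_coupling_kernel(2)[OF coupl K that] by (simp add: u_def)
  qed
  have curv_D: "ricci_curv P k (X w) (Y w) = 1 - enn2ereal (W1 (K (X w)) (K (Y w))) / ereal (D w)"
    and pos_D: "D w > 0" if "X w \<noteq> Y w" for w
    using that by (simp_all add: ricci_curv_def K_def D_def)
  have zero_D: "D w = 0" and zero_u: "u f w = 0" if "X w = Y w" for w f
    using that by (simp_all add: D_def u_def)

  \<comment> \<open>First inequality: an arbitrary coupling\<close>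
  define h where "h w = ereal (D w) * (1 - ricci_curv P k (X w) (Y w)) / ereal d" for w
  have h_nonneg: "h w \<ge> 0" for w
  proof (cases "X w = Y w")
    case True
    then show ?thesis by (simp add: h_def zero_D flip: zero_ereal_def)
  next
    case False
    then show ?thesis
      unfolding h_def curv_D[OF False]
      by (intro curvature_cost_bounds(3)[where u=0] pos_D d) auto
  qed
  have exp_h: "ereal_expectation M h = enn2ereal (\<integral>\<^sup>+w. e2ennreal (h w) \<partial>M)"
    using h_nonneg by (rule ereal_expectation_nonneg)
  show "1 - ereal_expectation M
      (\<lambda>w. ereal (dist (X w) (Y w)) * (1 - ricci_curv P k (X w) (Y w)) / ereal (dist x y))
      \<le> ricci_curv P (k + 1) x y"
    unfolding D_def[symmetric] d_def[symmetric] h_def[symmetric]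
  proof (cases "\<integral>\<^sup>+w. e2ennreal (h w) \<partial>M")
    case (real I)
    have "W1 (P x \<bind> K) (P y \<bind> K) \<le> ennreal (d * I)"
    proof (rule W1_le)
      fix f :: "'a \<Rightarrow> real" and B assume f: "\<And>z. \<bar>f z\<bar> \<le> B" "\<And>a b. f a - f b \<le> dist a b"
      note E = expectation_coupling_kernel[OF coupl K f, folded u_def]
      \<comment> \<open>Only the measurable \<open>u f\<close> is compared with \<open>h\<close>, so
        monotonicity of the integral suffices.\<close>
      have le: "ennreal (u f w / d) \<le> e2ennreal (h w)" for w
      proof (cases "X w = Y w")
        case False
        have "ereal (u f w / d) \<le> h w"
          unfolding h_def curv_D[OF False]
          by (intro curvature_cost_bounds(1) pos_D d False E(3))
        then show ?thesis
          using e2ennreal_mono by fastforce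
      qed (simp add: zero_u)
      have "ennreal (\<integral>w. u f w / d \<partial>M) \<le> (\<integral>\<^sup>+w. ennreal (u f w / d) \<partial>M)"
        using E(1) by (intro ennreal_integral_le_nn_integral) simp
      also have "\<dots> \<le> ennreal I"
        unfolding real(2)[symmetric] by (rule nn_integral_mono) (rule le)
      finally have "(\<integral>w. u f w / d \<partial>M) \<le> I"
        using real(1) by (simp add: ennreal_le_iff)
      then show "(\<integral>w. u f w \<partial>M) \<le> d * I"
        using d by (simp add: field_simps)
    qed
    then obtain r where r: "W1 (P x \<bind> K) (P y \<bind> K) = ennreal r" "0 \<le> r" "r \<le> d * I"
      using d real(1) by (cases "W1 (P x \<bind> K) (P y \<bind> K)") (auto simp: top_unique)
    then show "1 - ereal_expectation M h \<le> ricci_curv P (k + 1) x y"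
      using d real unfolding curv exp_h
      by (simp add: one_ereal_def enn2ereal_ennreal field_simps)
  next
    \<comment> \<open>An infinite expected cost makes the claimed lower bound minus
      infinity.\<close>
    case top
    then show "1 - ereal_expectation M h \<le> ricci_curv P (k + 1) x y"
      unfolding exp_h by (simp add: one_ereal_def)
  qed

  \<comment> \<open>Second inequality: an optimal coupling\<close>
  define \<phi> where "\<phi> w = ricci_curv P k (X w) (Y w) * ereal (D w) / ereal d" for w
  assume opt: "ereal_expectation M (\<lambda>w. ereal (dist (X w) (Y w))) = enn2ereal (W1 (P x) (P y))"
  define m where "m = (\<integral>w. D w \<partial>M)"
  have m: "m \<ge> 0"
    by (simp add: m_def D_def)
  have "W1 (P x) (P y) = (\<integral>\<^sup>+w. ennreal (D w) \<partial>M)"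
    using opt ereal_expectation_nonneg[of "\<lambda>w. ereal (D w)" M] by (simp add: D_def enn2ereal_inject)
  also have "\<dots> = ennreal m"
    unfolding m_def using int_D by (rule nn_integral_eq_integral) (simp add: D_def)
  finally have curv_1: "ricci_curv P 1 x y = ereal (1 - m / d)"
    using neq d m unfolding ricci_curv_def step_kernel_1[OF kernel]
    by (simp add: d_def[symmetric] enn2ereal_ennreal one_ereal_def)
  \<comment> \<open>\<phi> may take the value minus infinity, but it lies below the integrable
    \<open>(D w - u f w) / d\<close>.\<close>
  have exp_\<phi>: "ereal_expectation M \<phi> \<le> ereal ((m - (\<integral>w. u f w \<partial>M)) / d)"
    if f: "\<And>z. \<bar>f z\<bar> \<le> B" "\<And>a b. f a - f b \<le> dist a b" for f B
  proof -
    note E = expectation_coupling_kernel[OF coupl K f, folded u_def]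
    have "\<phi> w \<le> ereal ((D w - u f w) / d)" for w
    proof (cases "X w = Y w")
      case True
      then show ?thesis by (simp add: \<phi>_def zero_D zero_u flip: zero_ereal_def)
    next
      case False
      then show ?thesis
        unfolding \<phi>_def curv_D[OF False]
        by (intro curvature_cost_bounds(2) pos_D d E(3))
    qed
    then have "ereal_expectation M \<phi> \<le> ereal (\<integral>w. (D w - u f w) / d \<partial>M)"
      using E(1) int_D by (intro ereal_expectation_le) auto
    also have "(\<integral>w. (D w - u f w) / d \<partial>M) = (m - (\<integral>w. u f w \<partial>M)) / d"
      using E(1) int_D by (simp add: m_def)
    finally show ?thesis .
  qed
  show "ricci_curv P 1 x y + ereal_expectation M
      (\<lambda>w. ricci_curv P k (X w) (Y w) * ereal (dist (X w) (Y w)) / ereal (dist x y))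
      \<le> ricci_curv P (k + 1) x y"
    unfolding D_def[symmetric] d_def[symmetric] \<phi>_def[symmetric]
  proof (cases "ereal_expectation M \<phi>")
    case (real e)
    have bound: "(\<integral>w. u f w \<partial>M) \<le> m - d * e"
      if "\<And>z. \<bar>f z\<bar> \<le> B" "\<And>a b. f a - f b \<le> dist a b" for f B
      using exp_\<phi>[OF that] d unfolding real by (simp add: field_simps)
    \<comment> \<open>The zero test function supplies the sign without which
      \<open>ennreal (m - d * e)\<close> would collapse to 0.\<close>
    have "m - d * e \<ge> 0"
      using bound[of "\<lambda>_. 0" 0] by (simp add: u_def)
    moreover have "W1 (P x \<bind> K) (P y \<bind> K) \<le> ennreal (m - d * e)"
      using bound by (rule W1_le)
    ultimately obtain r where r: "W1 (P x \<bind> K) (P y \<bind> K) = ennreal r" "0 \<le> r" "r \<le> m - d * e"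
      by (cases "W1 (P x \<bind> K) (P y \<bind> K)") (auto simp: top_unique)
    have "1 - m / d + e \<le> 1 - r / d"
      using divide_right_mono[OF r(3), of d] d by (simp add: diff_divide_distrib)
    then show "ricci_curv P 1 x y + ereal_expectation M \<phi> \<le> ricci_curv P (k + 1) x y"
      using d r real unfolding curv curv_1
      by (simp add: one_ereal_def enn2ereal_ennreal)
  next
    \<comment> \<open>The zero test function bounds the expectation by \<open>m / d\<close>, which
      excludes this case.\<close>
    case PInf
    then show "ricci_curv P 1 x y + ereal_expectation M \<phi> \<le> ricci_curv P (k + 1) x y"
      using exp_\<phi>[of "\<lambda>_. 0" 0] by simp
  next
    case MInf
    then show "ricci_curv P 1 x y + ereal_expectation M \<phi> \<le> ricci_curv P (k + 1) x y"
      unfolding curv_1 by simp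
  qed
qed

end
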